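(* Assume that $\infty$ is natural for the diffusion $X$ and that $\lambda_0>0$. Let $\mu,\lambda\in(0,\lambda_0]$ with $\lambda\ne\mu$ and let $x>0$. Suppose the tail $\sigma$-field $\mathcal{T}$ is trivial under $\mathbb{P}^{[\psi_{-\lambda}]}_x$ and under $\mathbb{P}^{[\psi_{-\mu}]}_x$. Then the distributions $\mathbb{P}^{[\psi_{-\lambda}]}_x$ and $\mathbb{P}^{[\psi_{-\mu}]}_x$ are singular on $\mathcal{F}_\infty$. More explicitly, there exist constants $0\le c_1<1<c_2\le\infty$ such that $$\mathbb{P}^{[\psi_{-\lambda}]}_x\Big[\lim_{t\to\infty}\frac{M^{[\psi_{-\mu}]}_t}{M^{[\psi_{-\lambda}]}_t}=c_1\Big]=\mathbb{P}^{[\psi_{-\mu}]}_x\Big[\lim_{t\to\infty}\frac{M^{[\psi_{-\mu}]}_t}{M^{[\psi_{-\lambda}]}_t}=c_2\Big]=1.$$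
   Context: Path space. $\Omega$ is the set of functions $\omega:[0,\infty)\to(0,\infty)\cup\{\partial\}$ ($\partial$ an isolated cemetery point) that are continuous on $[0,\zeta(\omega))$ and equal to $\partial$ on $[\zeta(\omega),\infty)$, where $\zeta(\omega)=\inf\{t\ge 0\mid\omega(t)=\partial\}$. $X_t(\omega)=\omega(t)$, $\mathcal{F}_t=\bigcap_{s>t}\sigma(X_u,u\le s)$, $\mathcal{F}_\infty=\sigma(\bigcup_{t>0}\mathcal{F}_t)$. The tail $\sigma$-field is $\mathcal{T}=\bigcap_{t>0}\sigma(X_s,\ s>t)$; it is trivial under a probability $\mathbb{Q}$ when $\mathbb{Q}[A]\in\{0,1\}$ for every $A\in\mathcal{T}$. Every function $f$ on $(0,\infty)$ is extended by $f(\partial)=0$. $\mathbb{E}[Y,A]$ means $\mathbb{E}[Y1_A]$. The diffusion. $m$ is a Radon measure on $(0,\infty)$ with full support, and $X=((X_t),(\mathcal{F}_t),(\mathbb{P}_x)_{x>0})$ is the natural-scale diffusion on $(0,\infty)$ with generator $\frac{d}{dm}\frac{d^+}{dx}$ (speed measure $m$, scale function $s(x)=x$, no killing measure), killed exactly at $T_0=\lim_{x\to 0}T_x$, where $T_x=\inf\{t>0\mid X_t=x\}$. The boundary $0$ is regular or exit in Feller's sense (equivalently $\int_{(0,1]}x\,dm(x)<\infty$). The boundary $\infty$ being natural means $\int_{(1,\infty)}x\,dm(x)=\infty$. Spectral bottom and eigenfunctions. $\lambda_0:=-\sup\sigma(L_2)$, where $L_2$ is the generator of the strongly continuous extension to $L^2(m)$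 of the transition semigroup of $X$. For $q\in\mathbb{C}$, $\psi_q$ is the unique solution of $\psi_q(x)=x+q\int_0^x dy\int_0^y\psi_q(z)\,dm(z)$. For $\lambda\in(0,\lambda_0]$, $\psi_{-\lambda}$ is positive on $(0,\infty)$. $h$-transform. For $\lambda\in(0,\lambda_0]$, $M^{[\psi_{-\lambda}]}_t:=e^{\lambda t}\frac{\psi_{-\lambda}(X_t)}{\psi_{-\lambda}(X_0)}$ (equal to $0$ for $t\ge T_0$), which in the present situation is a martingale under each $\mathbb{P}_x$; $\mathbb{P}^{[\psi_{-\lambda}]}_x$ is the probability on $\mathcal{F}_\infty$ with $\mathbb{P}^{[\psi_{-\lambda}]}_x[A]=\mathbb{E}_x[M^{[\psi_{-\lambda}]}_t,A]$ for $t\ge 0$, $A\in\mathcal{F}_t$; it is the law of the conservative diffusion with speed measure $\psi_{-\lambda}^2dm$ and scale $dx/\psi_{-\lambda}^2$. *)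

theory Defs
  imports "HOL-Probability.Probability"
begin

section \<open>Path space\<close>

text \<open>A path is a function on \<open>[0,\<infinity>)\<close>, made \<^const>\<open>undefined\<close> on negative times so that paths are
  determined by their values on \<open>[0,\<infinity>)\<close>. The cemetery point is \<^const>\<open>None\<close>; the points of
  \<open>(0,\<infinity>)\<close> are \<open>Some y\<close>. Random times take values in \<^typ>\<open>ennreal\<close>, where \<open>inf {} = \<infinity>\<close>.\<close>

type_synonym path = "real \<Rightarrow> real option"

definition lifetime :: "path \<Rightarrow> ennreal" where
  "lifetime \<omega> = Inf {ennreal t | t. 0 \<le> t \<and> \<omega> t = None}"

definition paths :: "path set" where
  "paths = {\<omega> \<in> {0..} \<rightarrow>\<^sub>E insert None (Some ` {0<..}).
     continuous_on {t. 0 \<le> t \<and> ennreal t < lifetime \<omega>} (\<lambda>t. the (\<omega> t)) \<and>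
     (\<forall>t\<ge>0. lifetime \<omega> \<le> ennreal t \<longrightarrow> \<omega> t = None)}"

text \<open>The Borel \<open>\<sigma>\<close>-field of \<open>(0,\<infinity>) \<union> {\<partial>}\<close>; the singleton of the isolated point \<open>\<partial>\<close> is
  the complement of \<open>Some ` {0<..}\<close>.\<close>

definition state_space :: "real option measure" where
  "state_space = sigma (insert None (Some ` {0<..})) {Some ` B | B. B \<in> sets borel \<and> B \<subseteq> {0<..}}"

text \<open>\<open>sigma_X I\<close> is \<open>\<sigma>(X\<^sub>u, u \<in> I)\<close>.\<close>

definition sigma_X :: "real set \<Rightarrow> path set set" where
  "sigma_X I = sigma_sets paths {{\<omega> \<in> paths. \<omega> u \<in> B} | u B. u \<in> I \<and> B \<in> sets state_space}"

definition filt :: "real \<Rightarrow> path set set" where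
  "filt t = (\<Inter>s\<in>{t<..}. sigma_X {0..s})"

definition path_measurable :: "path measure" where
  "path_measurable = sigma paths (\<Union>t\<in>{0<..}. filt t)"

abbreviation filt_infinity :: "path set set" where
  "filt_infinity \<equiv> sets path_measurable"

definition tail_sigma :: "path set set" where
  "tail_sigma = (\<Inter>t\<in>{0<..}. sigma_X {t<..})"

definition tail_trivial :: "path measure \<Rightarrow> bool" where
  "tail_trivial Q \<longleftrightarrow> (\<forall>A\<in>tail_sigma. measure Q A \<in> {0, 1})"

definition hit :: "real \<Rightarrow> path \<Rightarrow> ennreal" where
  "hit y \<omega> = Inf {ennreal t | t. 0 < t \<and> \<omega> t = Some y}"

definition shift :: "real \<Rightarrow> path \<Rightarrow> path" where
  "shift t \<omega> = (\<lambda>u\<in>{0..}. \<omega> (t + u))"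

text \<open>Extension of a function on \<open>(0,\<infinity>)\<close> by \<open>f(\<partial>) = 0\<close>.\<close>

definition ext0 :: "(real \<Rightarrow> 'b::zero) \<Rightarrow> real option \<Rightarrow> 'b" where
  "ext0 f s = (case s of None \<Rightarrow> 0 | Some y \<Rightarrow> f y)"

text \<open>Stopping times may be infinite, which the library notion does not allow for real time.\<close>

definition stop_time :: "(path \<Rightarrow> ennreal) \<Rightarrow> bool" where
  "stop_time \<tau> \<longleftrightarrow> (\<forall>t\<ge>0. {\<omega> \<in> paths. \<tau> \<omega> \<le> ennreal t} \<in> filt t)"

definition filt_stop :: "(path \<Rightarrow> ennreal) \<Rightarrow> path set set" where
  "filt_stop \<tau> = {A \<in> filt_infinity. \<forall>t\<ge>0. A \<inter> {\<omega>. \<tau> \<omega> \<le> ennreal t} \<in> filt t}"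

section \<open>The diffusion with speed measure \<open>m\<close> in natural scale\<close>

definition radon_full_support :: "real measure \<Rightarrow> bool" where
  "radon_full_support m \<longleftrightarrow>
     sets m = sets (restrict_space borel {0<..}) \<and>
     (\<forall>K. compact K \<and> K \<subseteq> {0<..} \<longrightarrow> emeasure m K < \<infinity>) \<and>
     (\<forall>U. open U \<and> U \<noteq> {} \<and> U \<subseteq> {0<..} \<longrightarrow> 0 < emeasure m U)"

text \<open>The Markov property is only stated on \<open>{\<tau> < \<zeta>}\<close>: from \<open>\<zeta>\<close> on the path rests at \<open>\<partial>\<close>,
  so that nothing remains to be required there.\<close>

definition strong_markov :: "(real \<Rightarrow> path measure) \<Rightarrow> bool" where
  "strong_markov P \<longleftrightarrow>
     (\<forall>x>0. \<forall>\<tau>. stop_time \<tau> \<longrightarrow> (\<forall>A\<in>filt_stop \<tau>. \<forall>B\<in>filt_infinity.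
        emeasure (P x) {\<omega> \<in> A. \<tau> \<omega> < lifetime \<omega> \<and> shift (enn2real (\<tau> \<omega>)) \<omega> \<in> B} =
        (\<integral>\<^sup>+ \<omega> \<in> {\<omega> \<in> A. \<tau> \<omega> < lifetime \<omega>}.
           emeasure (P (the (\<omega> (enn2real (\<tau> \<omega>))))) B \<partial>P x)))"

text \<open>A strong Markov family on the path space with scale function \<open>s(x) = x\<close> (exit probabilities)
  and speed measure \<open>m\<close> (mean exit times, through the Green function of \<open>-(d/dm)(d\<^sup>+/dx)\<close> on
  \<open>(a,b)\<close>), whose lifetime is \<open>T\<^sub>0 = lim\<^bsub>y\<rightarrow>0\<^esub> T\<^sub>y\<close>; in particular there is no killing inside
  \<open>(0,\<infinity>)\<close>. The normalisation is that of the generator \<open>(d/dm)(d\<^sup>+/dx)\<close>: on \<open>(a,b)\<close> the function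
  \<open>u(x) = E\<^sub>x[T\<^sub>a \<and> T\<^sub>b]\<close> solves \<open>(d/dm)(d\<^sup>+u/dx) = -1\<close>, \<open>u(a) = u(b) = 0\<close>.\<close>

definition natural_scale_diffusion :: "real measure \<Rightarrow> (real \<Rightarrow> path measure) \<Rightarrow> bool" where
  "natural_scale_diffusion m P \<longleftrightarrow>
     P \<in> restrict_space borel {0<..} \<rightarrow>\<^sub>M prob_algebra path_measurable \<and>
     (\<forall>x>0. measure (P x) {\<omega> \<in> paths. \<omega> 0 = Some x} = 1) \<and>
     strong_markov P \<and>
     (\<forall>a x b. 0 < a \<and> a < x \<and> x < b \<longrightarrow>
        measure (P x) {\<omega> \<in> paths. hit b \<omega> < hit a \<omega>} = (x - a) / (b - a)) \<and>
     (\<forall>a x b. 0 < a \<and> a < x \<and> x < b \<longrightarrow>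
        (\<integral>\<^sup>+ \<omega>. min (hit a \<omega>) (hit b \<omega>) \<partial>P x) =
        (\<integral>\<^sup>+ y\<in>{a<..<b}. ennreal ((min x y - a) * (b - max x y) / (b - a)) \<partial>m)) \<and>
     (\<forall>x>0. AE \<omega> in P x. ((\<lambda>y. hit y \<omega>) \<longlongrightarrow> lifetime \<omega>) (at_right 0))"

definition zero_regular_or_exit :: "real measure \<Rightarrow> bool" where
  "zero_regular_or_exit m \<longleftrightarrow> (\<integral>\<^sup>+ x\<in>{0<..1}. ennreal x \<partial>m) < \<infinity>"

definition infinity_natural :: "real measure \<Rightarrow> bool" where
  "infinity_natural m \<longleftrightarrow> (\<integral>\<^sup>+ x\<in>{1<..}. ennreal x \<partial>m) = \<infinity>"

section \<open>The bottom of the spectrum\<close>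

definition L2_sq :: "real measure \<Rightarrow> (real \<Rightarrow> complex) \<Rightarrow> ennreal" where
  "L2_sq m f = (\<integral>\<^sup>+ x. ennreal ((cmod (f x))\<^sup>2) \<partial>m)"

text \<open>Elements of \<open>L\<^sup>2(m)\<close> are represented by functions, equality being almost everywhere.\<close>

definition L2_fun :: "real measure \<Rightarrow> (real \<Rightarrow> complex) set" where
  "L2_fun m = {f \<in> borel_measurable m. L2_sq m f < \<infinity>}"

text \<open>The semigroup is \<open>m\<close>-symmetric, hence contractive on \<open>L\<^sup>2(m)\<close>. For \<open>f\<close> in \<open>L\<^sup>2(m)\<close> the
  integral converges for \<open>m\<close>-almost every starting point, its class depends on the class of \<open>f\<close> only,
  and it is the value at \<open>f\<close> of the continuous extension of the semigroup to \<open>L\<^sup>2(m)\<close>.\<close>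

definition transition :: "(real \<Rightarrow> path measure) \<Rightarrow> real \<Rightarrow> (real \<Rightarrow> complex) \<Rightarrow> real \<Rightarrow> complex" where
  "transition P t f y = (LINT \<omega>|P y. ext0 f (\<omega> t))"

text \<open>\<open>L2_generator m P f g\<close>: \<open>f\<close> is in the domain of \<open>L\<^sub>2\<close> and \<open>L\<^sub>2 f = g\<close>.\<close>

definition L2_generator ::
    "real measure \<Rightarrow> (real \<Rightarrow> path measure) \<Rightarrow> (real \<Rightarrow> complex) \<Rightarrow> (real \<Rightarrow> complex) \<Rightarrow> bool" where
  "L2_generator m P f g \<longleftrightarrow> f \<in> L2_fun m \<and> g \<in> L2_fun m \<and>
     ((\<lambda>t. L2_sq m (\<lambda>y. (transition P t f y - f y) / complex_of_real t - g y)) \<longlongrightarrow> 0) (at_right 0)"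

text \<open>\<open>q\<close> is in the resolvent set of the operator with graph \<open>L\<close> when \<open>q - L\<close> maps its domain
  bijectively onto \<open>L\<^sup>2(m)\<close> with bounded inverse.\<close>

definition L2_resolvent_set ::
    "real measure \<Rightarrow> ((real \<Rightarrow> complex) \<Rightarrow> (real \<Rightarrow> complex) \<Rightarrow> bool) \<Rightarrow> complex set" where
  "L2_resolvent_set m L = {q.
     (\<forall>f h. L f h \<and> (AE y in m. q * f y - h y = 0) \<longrightarrow> (AE y in m. f y = 0)) \<and>
     (\<exists>C::real. \<forall>g\<in>L2_fun m. \<exists>f h. L f h \<and> (AE y in m. q * f y - h y = g y) \<and>
        L2_sq m f \<le> ennreal C * L2_sq m g)}"

definition L2_spectrum ::
    "real measure \<Rightarrow> ((real \<Rightarrow> complex) \<Rightarrow> (real \<Rightarrow> complex) \<Rightarrow> bool) \<Rightarrow> complex set" where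
  "L2_spectrum m L = - L2_resolvent_set m L"

text \<open>\<open>L\<^sub>2\<close> is self-adjoint, so its spectrum is real and taking real parts only changes the type.\<close>

definition lambda0 :: "real measure \<Rightarrow> (real \<Rightarrow> path measure) \<Rightarrow> real" where
  "lambda0 m P = - Sup (Re ` L2_spectrum m (L2_generator m P))"

section \<open>Eigenfunctions and the \<open>h\<close>-transform\<close>

text \<open>The defining equation of \<open>\<psi>\<^sub>q\<close> on \<open>(0,\<infinity>)\<close>, with the integrals required to converge
  absolutely; when \<open>0\<close> is regular or exit it has exactly one solution. An atom of \<open>m\<close> at the
  end point \<open>y\<close> of the inner integral does not matter, there being only countably many. Values
  at \<open>x \<le> 0\<close> are irrelevant.\<close>

definition psi_equation :: "real measure \<Rightarrow> real \<Rightarrow> (real \<Rightarrow> real) \<Rightarrow> bool" where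
  "psi_equation m q \<psi> \<longleftrightarrow> (\<forall>x>0.
     set_integrable m {0<..x} \<psi> \<and>
     set_integrable lborel {0..x} (\<lambda>y. LINT z:{0<..y}|m. \<psi> z) \<and>
     \<psi> x = x + q * (LINT y:{0..x}|lborel. (LINT z:{0<..y}|m. \<psi> z)))"

text \<open>Vanishing for \<open>t \<ge> T\<^sub>0\<close> is built in, since \<open>\<psi>(\<partial>) = 0\<close>.\<close>

definition M_process :: "(real \<Rightarrow> real) \<Rightarrow> real \<Rightarrow> real \<Rightarrow> path \<Rightarrow> real" where
  "M_process \<psi> l t \<omega> = exp (l * t) * (ext0 \<psi> (\<omega> t) / ext0 \<psi> (\<omega> 0))"

text \<open>\<open>Q\<close> is the probability \<open>P\<^sup>[\<^sup>\<psi>\<^sup>]\<^sub>x\<close>; it is unique, the \<open>F\<^sub>t\<close> generating \<open>F\<^sub>\<infinity>\<close>.\<close>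

definition h_transform_law ::
    "(real \<Rightarrow> path measure) \<Rightarrow> (real \<Rightarrow> real) \<Rightarrow> real \<Rightarrow> real \<Rightarrow> path measure \<Rightarrow> bool" where
  "h_transform_law P \<psi> l x Q \<longleftrightarrow> prob_space Q \<and> sets Q = filt_infinity \<and>
     (\<forall>t\<ge>0. \<forall>A\<in>filt t. measure Q A = (LINT \<omega>:A|P x. M_process \<psi> l t \<omega>))"

definition mutually_singular :: "'a measure \<Rightarrow> 'a measure \<Rightarrow> bool" where
  "mutually_singular Q R \<longleftrightarrow> sets Q = sets R \<and>
     (\<exists>A\<in>sets Q. emeasure Q A = 0 \<and> emeasure R (space R - A) = 0)"

end

theory Submission
  imports Defs
begin

text \<open>
  Write \<open>M\<^sub>t\<close> for the density of \<open>Qlam\<close> and \<open>N\<^sub>t\<close> for that of \<open>Qmu\<close> with respect to \<open>P x\<close> on \<open>\<F>\<^sub>t\<close>. Then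
  \<open>R\<^sub>t = N\<^sub>t / M\<^sub>t\<close> is the density process that compares \<open>Qmu\<close> with \<open>Qlam\<close>. Up to a constant factor it
  is a function of \<open>t\<close> and \<open>X\<^sub>t\<close>, so its upper limit is tail measurable and equals a
  constant \<open>c\<close> almost surely under \<open>Qlam\<close>.

  Let \<open>a < b < c\<close> and \<open>A = {R\<^sub>s \<le> a}\<close>. As the density is at most \<open>a\<close> on \<open>A\<close>, we have
  \<open>Qmu A \<le> a * Qlam A\<close>. But \<open>Qlam\<close>-almost every path of \<open>A\<close> exceeds the level \<open>b\<close> at a later time, and
  decomposing by the first such time gives \<open>b * Qlam A \<le> Qmu A\<close>. Hence \<open>A\<close> is null under \<open>Qlam\<close>, so
  \<open>R\<^sub>s \<ge> c\<close> almost surely for every \<open>s\<close>, and \<open>R\<^sub>t\<close> converges to its upper limit \<open>c\<close>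
  (\<open>AE_ratio_gt_of_exceeds\<close>, \<open>zero_one_limit\<close>). From \<open>R\<^sub>0 = 1\<close> it follows that \<open>c \<le> 1\<close>.

  If \<open>c = 1\<close>, then \<open>R\<^sub>s \<ge> 1\<close> for every \<open>s\<close>, so \<open>Qmu\<close> dominates \<open>Qlam\<close> on each \<open>\<F>\<^sub>s\<close>. As both are
  probabilities, they agree there, and \<open>M\<^sub>s = N\<^sub>s\<close> almost surely under \<open>P x\<close>. With positive probability,
  however, the diffusion visits points on both sides of \<open>x\<close> at positive times and therefore
  returns to \<open>x\<close> at some time \<open>s > 0\<close>, where \<open>N\<^sub>s / M\<^sub>s = exp ((mu - lam) * s)\<close>. So \<open>c < 1\<close> (\<open>limit_less_1\<close>,
  \<open>returns\<close>). Exchanging the roles of the two laws, \<open>1 / R\<^sub>t\<close> tends to a constant \<open>d < 1\<close> under \<open>Qmu\<close>,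
  that is, \<open>R\<^sub>t\<close> tends to \<open>1 / d > 1\<close>, or to infinity if \<open>d = 0\<close>. Since the two limits differ, the two laws
  live on disjoint events.

  All this presupposes that the eigenfunctions are positive, which follows from the existence of the two laws: a
  density is nonnegative, and the diffusion visits every point, so \<open>\<psi>\<close> does not change sign; the integral
  equation then rules out nonpositive \<open>\<psi>\<close> and, by concavity, zeros (\<open>eigenfunction_sign\<close>, \<open>psi_positive\<close>).
\<close>

section \<open>The \<open>\<sigma>\<close>-fields of path space\<close>

lemma sigma_X_subset_Pow: "sigma_X I \<subseteq> Pow paths"
  unfolding sigma_X_def by (intro subsetI PowI sigma_sets_into_sp) auto

lemma sigma_algebra_sigma_X: "sigma_algebra paths (sigma_X I)"
  unfolding sigma_X_def by (rule sigma_algebra_sigma_sets) auto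

lemma sigma_X_mono: "I \<subseteq> J \<Longrightarrow> sigma_X I \<subseteq> sigma_X J"
  unfolding sigma_X_def by (rule sigma_sets_mono') blast

lemma filt_subset_Pow: "filt t \<subseteq> Pow paths"
proof -
  have "filt t \<subseteq> sigma_X {0..t + 1}" unfolding filt_def by (rule INF_lower) simp
  then show ?thesis using sigma_X_subset_Pow by (rule subset_trans)
qed

lemma sigma_algebra_filt: "sigma_algebra paths (filt t)"
proof -
  interpret sigma_algebra paths "sigma_X I" for I by (rule sigma_algebra_sigma_X)
  show ?thesis
    unfolding sigma_algebra_iff2
  proof (intro conjI allI impI ballI)
    show "filt t \<subseteq> Pow paths" by (rule filt_subset_Pow)
    show "{} \<in> filt t" unfolding filt_def by simp
    show "paths - A \<in> filt t" if "A \<in> filt t" for A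
      using that unfolding filt_def by blast
    show "(\<Union>i. A i) \<in> filt t" if "range A \<subseteq> filt t" for A :: "nat \<Rightarrow> path set"
      unfolding filt_def
    proof (rule INT_I)
      fix s assume "s \<in> {t<..}"
      then have "range A \<subseteq> sigma_X {0..s}" using that unfolding filt_def by blast
      then show "(\<Union>i. A i) \<in> sigma_X {0..s}" by (rule countable_nat_UN)
    qed
  qed
qed

lemma filt_mono: "s \<le> t \<Longrightarrow> filt s \<subseteq> filt t"
  unfolding filt_def by (rule INF_superset_mono) auto

lemma sigma_X_subset_filt: "sigma_X {0..t} \<subseteq> filt t"
  unfolding filt_def by (intro INT_greatest sigma_X_mono) auto

lemma Union_filt_subset_Pow: "(\<Union>t\<in>{0<..}. filt t) \<subseteq> Pow paths"
  by (rule UN_least) (rule filt_subset_Pow)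

lemma space_path_measurable [simp]: "space path_measurable = paths"
  unfolding path_measurable_def by (rule space_measure_of) (rule Union_filt_subset_Pow)

lemma filt_subset_filt_infinity: "filt t \<subseteq> filt_infinity"
proof -
  have "filt t \<subseteq> filt (max t 1)" by (rule filt_mono) simp
  also have "\<dots> \<subseteq> filt_infinity"
    unfolding path_measurable_def sets_measure_of[OF Union_filt_subset_Pow]
    by (intro subsetI sigma_sets.Basic UN_I[of "max t 1"]) auto
  finally show ?thesis .
qed

lemma sets_sigma_filt [simp]: "sets (sigma paths (filt t)) = filt t"
  unfolding sets_measure_of[OF filt_subset_Pow]
  by (rule sigma_algebra.sigma_sets_eq[OF sigma_algebra_filt])

lemma sets_sigma_sigma_X [simp]: "sets (sigma paths (sigma_X I)) = sigma_X I"
  unfolding sets_measure_of[OF sigma_X_subset_Pow]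
  by (rule sigma_algebra.sigma_sets_eq[OF sigma_algebra_sigma_X])

lemma space_sigma_sigma_X [simp]: "space (sigma paths (sigma_X I)) = paths"
  by (rule space_measure_of) (rule sigma_X_subset_Pow)

lemma space_sigma_filt [simp]: "space (sigma paths (filt t)) = paths"
  by (rule space_measure_of) (rule filt_subset_Pow)

lemma measurable_sigma_X_filt:
  "f \<in> sigma paths (sigma_X {0..t}) \<rightarrow>\<^sub>M N \<Longrightarrow> f \<in> sigma paths (filt t) \<rightarrow>\<^sub>M N"
  unfolding measurable_def space_sigma_sigma_X space_sigma_filt sets_sigma_sigma_X sets_sigma_filt
  using sigma_X_subset_filt[of t] by blast

lemma measurable_filt_infinity:
  "f \<in> sigma paths (filt t) \<rightarrow>\<^sub>M N \<Longrightarrow> f \<in> path_measurable \<rightarrow>\<^sub>M N"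
  unfolding measurable_def space_path_measurable space_sigma_filt sets_sigma_filt
  using filt_subset_filt_infinity[of t] by blast

lemma space_state_space: "space state_space = insert None (Some ` {0<..})"
  unfolding state_space_def by (rule space_measure_of) auto

lemma Some_image_in_state_space:
  "B \<in> sets borel \<Longrightarrow> B \<subseteq> {0<..} \<Longrightarrow> Some ` B \<in> sets state_space"
  unfolding state_space_def by (subst sets_measure_of) auto

lemma None_in_state_space: "{None} \<in> sets state_space"
proof -
  have "{None} = space state_space - Some ` {0<..}"
    by (auto simp: space_state_space)
  also have "\<dots> \<in> sets state_space"
    by (intro sets.compl_sets Some_image_in_state_space) auto
  finally show ?thesis .
qed

lemma path_at_in_state_space: "\<omega> \<in> paths \<Longrightarrow> 0 \<le> u \<Longrightarrow> \<omega> u \<in> space state_space"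
  unfolding paths_def space_state_space by auto

lemma measurable_coordinate:
  assumes "u \<in> I" "0 \<le> u"
  shows "(\<lambda>\<omega>. \<omega> u) \<in> sigma paths (sigma_X I) \<rightarrow>\<^sub>M state_space"
proof (rule measurableI)
  fix B assume B: "B \<in> sets state_space"
  have "(\<lambda>\<omega>. \<omega> u) -` B \<inter> space (sigma paths (sigma_X I)) = {\<omega> \<in> paths. \<omega> u \<in> B}"
    by auto
  also have "\<dots> \<in> sigma_X I"
    unfolding sigma_X_def using assms B by (intro sigma_sets.Basic) auto
  finally show "(\<lambda>\<omega>. \<omega> u) -` B \<inter> space (sigma paths (sigma_X I)) \<in> sets (sigma paths (sigma_X I))"
    by simp
qed (use path_at_in_state_space assms in auto)

lemma measurable_ext0:
  fixes \<phi> :: "real \<Rightarrow> real"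
  assumes "continuous_on {0<..} \<phi>"
  shows "ext0 \<phi> \<in> borel_measurable state_space"
proof (rule measurableI)
  fix B :: "real set" assume "B \<in> sets borel"
  have "\<phi> \<in> borel_measurable (restrict_space borel {0<..})"
    by (rule borel_measurable_continuous_on_restrict) (rule assms)
  then have "\<phi> -` B \<inter> space (restrict_space borel {0<..}) \<in> sets (restrict_space borel {0<..})"
    using \<open>B \<in> sets borel\<close> by (rule measurable_sets)
  then have *: "\<phi> -` B \<inter> {0<..} \<in> sets borel"
    by (simp add: space_restrict_space sets_restrict_space_iff)
  have "ext0 \<phi> -` B \<inter> space state_space
      = Some ` (\<phi> -` B \<inter> {0<..}) \<union> (if 0 \<in> B then {None} else {})"
    by (auto simp: ext0_def space_state_space)
  also have "\<dots> \<in> sets state_space"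
    using Some_image_in_state_space[OF *] None_in_state_space by (intro sets.Un) auto
  finally show "ext0 \<phi> -` B \<inter> space state_space \<in> sets state_space" .
qed auto

lemma borel_measurable_ext0_coordinate:
  fixes \<phi> :: "real \<Rightarrow> real"
  assumes "continuous_on {0<..} \<phi>" "u \<in> I" "0 \<le> u"
  shows "(\<lambda>\<omega>. ext0 \<phi> (\<omega> u)) \<in> borel_measurable (sigma paths (sigma_X I))"
  by (rule measurable_compose[OF measurable_coordinate[OF assms(2,3)] measurable_ext0[OF assms(1)]])

section \<open>Paths up to their lifetime\<close>

lemma path_Some_iff: "\<omega> \<in> paths \<Longrightarrow> 0 \<le> t \<Longrightarrow> \<omega> t \<noteq> None \<longleftrightarrow> ennreal t < lifetime \<omega>"
proof
  assume "\<omega> \<in> paths" "0 \<le> t" "\<omega> t \<noteq> None"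
  then show "ennreal t < lifetime \<omega>"
    unfolding paths_def mem_Collect_eq by (meson not_le)
next
  assume "0 \<le> t" and *: "ennreal t < lifetime \<omega>"
  show "\<omega> t \<noteq> None"
  proof
    assume "\<omega> t = None"
    with \<open>0 \<le> t\<close> have "lifetime \<omega> \<le> ennreal t"
      unfolding lifetime_def by (intro Inf_lower) auto
    with * show False by simp
  qed
qed

lemma path_range: "\<omega> \<in> paths \<Longrightarrow> 0 \<le> t \<Longrightarrow> \<omega> t = Some y \<Longrightarrow> 0 < y"
  using path_at_in_state_space[of \<omega> t] unfolding space_state_space by fastforce

lemma path_alive_before:
  assumes "\<omega> \<in> paths" "0 \<le> s" "s \<le> t" "\<omega> t \<noteq> None"
  shows "\<omega> s \<noteq> None"
proof -
  have "ennreal s \<le> ennreal t" using assms by (intro ennreal_leI)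
  also have "\<dots> < lifetime \<omega>" using assms by (subst path_Some_iff[symmetric]) auto
  finally show ?thesis using assms by (subst path_Some_iff) auto
qed

lemma path_alive_after:
  assumes "\<omega> \<in> paths" "0 \<le> t" "\<omega> t \<noteq> None"
  obtains u where "t < u" "\<omega> u \<noteq> None"
proof -
  have "ennreal t < lifetime \<omega>" using assms by (subst path_Some_iff[symmetric]) auto
  then obtain v where v: "ennreal t < v" "v < lifetime \<omega>"
    using dense[of "ennreal t" "lifetime \<omega>"] by auto
  then obtain u where u: "v = ennreal u" "0 \<le> u" by (cases v) auto
  then have "t < u" using v assms by (simp add: ennreal_less_iff)
  moreover have "\<omega> u \<noteq> None" using u v assms by (subst path_Some_iff) auto
  ultimately show ?thesis by (rule that)
qed

lemma continuous_on_path: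
  assumes "\<omega> \<in> paths"
  shows "continuous_on {t. 0 \<le> t \<and> \<omega> t \<noteq> None} (\<lambda>t. the (\<omega> t))"
proof -
  have "{t. 0 \<le> t \<and> \<omega> t \<noteq> None} = {t. 0 \<le> t \<and> ennreal t < lifetime \<omega>}"
    by (rule Collect_cong) (use path_Some_iff[OF assms] in blast)
  then show ?thesis using assms by (simp add: paths_def)
qed

lemma continuous_on_ext0_path:
  fixes \<phi> :: "real \<Rightarrow> real"
  assumes "\<omega> \<in> paths" "continuous_on {0<..} \<phi>"
  shows "continuous_on {t. 0 \<le> t \<and> \<omega> t \<noteq> None} (\<lambda>t. ext0 \<phi> (\<omega> t))"
proof -
  have "continuous_on {t. 0 \<le> t \<and> \<omega> t \<noteq> None} (\<lambda>t. \<phi> (the (\<omega> t)))"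
    by (rule continuous_on_compose2[OF assms(2) continuous_on_path[OF assms(1)]])
      (use path_range[OF assms(1)] in auto)
  then show ?thesis
    by (rule continuous_on_eq) (auto simp: ext0_def split: option.split)
qed

text \<open>Continuity on the lifetime carries closed conditions from rational times to all times. Later
  rational times suffice, because a path alive at \<open>t\<close> stays alive for a while.\<close>

lemma closed_at_alive_time:
  fixes f :: "real \<Rightarrow> real"
  assumes \<omega>: "\<omega> \<in> paths" and f: "continuous_on {t. 0 \<le> t \<and> \<omega> t \<noteq> None} f"
    and "closed C" and C: "\<And>u. u \<in> \<rat> \<Longrightarrow> t < u \<Longrightarrow> \<omega> u \<noteq> None \<Longrightarrow> f u \<in> C"
    and t: "0 \<le> t" "\<omega> t \<noteq> None"
  shows "f t \<in> C"
proof (rule ccontr)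
  assume "f t \<notin> C"
  then obtain e where "e > 0" and e: "ball (f t) e \<subseteq> - C"
    using \<open>closed C\<close> open_contains_ball[of "- C"] by blast
  obtain d where "d > 0" and d: "\<And>u. 0 \<le> u \<Longrightarrow> \<omega> u \<noteq> None \<Longrightarrow> dist u t < d \<Longrightarrow> dist (f u) (f t) < e"
    using f[unfolded continuous_on_iff] t \<open>e > 0\<close> by blast
  obtain v where v: "t < v" "\<omega> v \<noteq> None" using path_alive_after[OF \<omega> t] by blast
  obtain u where u: "u \<in> \<rat>" "t < u" "u < min v (t + d)"
    using Rats_dense_in_real[of t "min v (t + d)"] v \<open>d > 0\<close> by auto
  have "\<omega> u \<noteq> None" using path_alive_before[OF \<omega> _ _ v(2), of u] u t by auto
  moreover have "dist u t < d" using u by (auto simp: dist_real_def)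
  ultimately have "f u \<in> ball (f t) e" using d[of u] u t by (auto simp: dist_commute)
  then show False using C[of u] u e \<open>\<omega> u \<noteq> None\<close> by auto
qed

section \<open>Laws with an \<open>h\<close>-transform density\<close>

text \<open>The process \<open>M\<^sub>t\<close> with the deterministic \<open>\<phi> x\<close> in place of \<open>\<phi>(X\<^sub>0)\<close>. The two agree on paths
  started at \<open>x\<close>, and for \<open>t > 0\<close> this version does not involve \<open>X\<^sub>0\<close>, which makes
  asymptotic events about it tail events.\<close>

definition h_density :: "(real \<Rightarrow> real) \<Rightarrow> real \<Rightarrow> real \<Rightarrow> real \<Rightarrow> path \<Rightarrow> real" where
  "h_density \<phi> l x t \<omega> = exp (l * t) * (ext0 \<phi> (\<omega> t) / \<phi> x)"

lemma M_process_eq_h_density: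
  "\<omega> 0 = Some x \<Longrightarrow> M_process \<psi> l t \<omega> = h_density \<psi> l x t \<omega>"
  by (simp add: M_process_def h_density_def ext0_def)

lemma borel_measurable_h_density:
  assumes "continuous_on {0<..} \<phi>" "t \<in> I" "0 \<le> t"
  shows "h_density \<phi> l x t \<in> borel_measurable (sigma paths (sigma_X I))"
  unfolding h_density_def
  by (intro borel_measurable_times borel_measurable_divide borel_measurable_const
      borel_measurable_ext0_coordinate assms)

lemma continuous_on_h_density:
  assumes "\<omega> \<in> paths" "continuous_on {0<..} \<phi>" "\<phi> x \<noteq> 0"
  shows "continuous_on {t. 0 \<le> t \<and> \<omega> t \<noteq> None} (\<lambda>t. h_density \<phi> l x t \<omega>)"
  unfolding h_density_def
  by (intro continuous_intros continuous_on_ext0_path) (use assms in auto)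

lemma AE_notin_of_set_integral_nonpos:
  fixes f :: "'a \<Rightarrow> real"
  assumes f: "integrable p f" and A: "A \<in> sets p" and pos: "\<And>\<omega>. \<omega> \<in> A \<Longrightarrow> 0 < f \<omega>"
    and le: "(LINT \<omega>:A|p. f \<omega>) \<le> 0"
  shows "AE \<omega> in p. \<omega> \<notin> A"
proof -
  let ?g = "\<lambda>\<omega>. indicator A \<omega> *\<^sub>R f \<omega>"
  have int: "integrable p ?g" by (rule integrable_mult_indicator[OF A f])
  have nn: "AE \<omega> in p. 0 \<le> ?g \<omega>"
    using pos by (intro AE_I2) (auto simp: indicator_def intro: less_imp_le)
  have "integral\<^sup>L p ?g = 0"
    using le integral_nonneg_AE[OF nn] by (simp add: set_lebesgue_integral_def)
  then have "AE \<omega> in p. ?g \<omega> = 0"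
    using integral_nonneg_eq_0_iff_AE[OF int nn] by simp
  then show ?thesis
  proof eventually_elim
    case (elim \<omega>)
    then show ?case using pos[of \<omega>] by auto
  qed
qed

text \<open>Before the lifetime the quotient is continuous, and afterwards it is the constant \<open>0 / 0 = 0\<close>; so it
  is right-continuous, and closed conditions at late rational times hold at all late times.\<close>

lemma density_ratio_closed:
  assumes \<omega>: "\<omega> \<in> paths" and cont: "continuous_on {0<..} \<phi>1" "continuous_on {0<..} \<phi>2"
    and pos: "\<And>y. 0 < y \<Longrightarrow> 0 < \<phi>1 y" "\<And>y. 0 < y \<Longrightarrow> 0 < \<phi>2 y"
    and "0 < x" "closed C" "0 \<le> t"
    and C: "\<And>u. u \<in> \<rat> \<Longrightarrow> t < u \<Longrightarrow> h_density \<phi>2 l2 x u \<omega> / h_density \<phi>1 l1 x u \<omega> \<in> C"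
  shows "h_density \<phi>2 l2 x t \<omega> / h_density \<phi>1 l1 x t \<omega> \<in> C"
proof (cases "\<omega> t = None")
  case True
  obtain u where u: "u \<in> \<rat>" "t < u" using Rats_dense_in_real[of t "t + 1"] by auto
  then have "\<omega> u = None"
    using path_alive_before[OF \<omega> \<open>0 \<le> t\<close> less_imp_le[OF u(2)]] True by (cases "\<omega> u") simp_all
  then show ?thesis using True C[OF u] by (simp add: h_density_def ext0_def)
next
  case False
  have "h_density \<phi>1 l1 x u \<omega> \<noteq> 0" if "0 \<le> u" "\<omega> u \<noteq> None" for u
    using that path_range[OF \<omega> that(1)] pos(1) \<open>0 < x\<close>
    by (auto simp: h_density_def ext0_def less_le split: option.split)
  then have "continuous_on {t. 0 \<le> t \<and> \<omega> t \<noteq> None}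
      (\<lambda>t. h_density \<phi>2 l2 x t \<omega> / h_density \<phi>1 l1 x t \<omega>)"
    using pos(1)[OF \<open>0 < x\<close>] pos(2)[OF \<open>0 < x\<close>]
    by (intro continuous_on_divide continuous_on_h_density \<omega> cont) auto
  then show ?thesis
    by (rule closed_at_alive_time[OF \<omega> _ \<open>closed C\<close>]) (use C False \<open>0 \<le> t\<close> in auto)
qed

text \<open>The law \<open>Q\<close> of the \<open>h\<close>-transform by a positive \<open>\<phi>\<close>, seen through its densities with respect
  to the law \<open>p\<close> of the diffusion started at \<open>x\<close>.\<close>

locale h_transformed =
  fixes p :: "path measure" and \<phi> :: "real \<Rightarrow> real" and l x :: real and Q :: "path measure"
  assumes sets_p: "sets p = filt_infinity"
    and prob_Q: "prob_space Q" and sets_Q: "sets Q = filt_infinity"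
    and continuous: "continuous_on {0<..} \<phi>" and positive: "\<And>y. 0 < y \<Longrightarrow> 0 < \<phi> y"
    and x_pos: "0 < x"
    and integrable_density: "\<And>t. 0 \<le> t \<Longrightarrow> integrable p (h_density \<phi> l x t)"
    and measure_eq: "\<And>t A. 0 \<le> t \<Longrightarrow> A \<in> filt t \<Longrightarrow>
      measure Q A = (LINT \<omega>:A|p. h_density \<phi> l x t \<omega>)"
    and start: "AE \<omega> in Q. \<omega> 0 = Some x"
begin

lemma filt_sets: "A \<in> filt t \<Longrightarrow> A \<in> sets Q" "A \<in> filt t \<Longrightarrow> A \<in> sets p"
  using filt_subset_filt_infinity sets_Q sets_p by auto

lemma space_Q: "space Q = paths"
  using sets_eq_imp_space_eq[OF sets_Q] by simp

lemma density_pos: "\<omega> \<in> paths \<Longrightarrow> 0 \<le> t \<Longrightarrow> \<omega> t \<noteq> None \<Longrightarrow> 0 < h_density \<phi> l x t \<omega>"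
  using path_range[of \<omega> t] positive x_pos
  by (auto simp: h_density_def ext0_def split: option.split)

lemma density_dead: "\<omega> t = None \<Longrightarrow> h_density \<phi> l x t \<omega> = 0"
  by (simp add: h_density_def ext0_def)

lemma density_nonneg: "\<omega> \<in> paths \<Longrightarrow> 0 \<le> t \<Longrightarrow> 0 \<le> h_density \<phi> l x t \<omega>"
  using density_pos[of \<omega> t] density_dead[of \<omega> t] by (cases "\<omega> t = None") auto

lemma set_integrable_density: "0 \<le> t \<Longrightarrow> A \<in> filt t \<Longrightarrow> set_integrable p A (h_density \<phi> l x t)"
  unfolding set_integrable_def
  by (intro integrable_mult_indicator integrable_density filt_sets)

text \<open>The density vanishes on dead paths, so the transformed law does not charge \<open>{X\<^sub>n = \<partial>}\<close>;
  integer times suffice because death is irrevocable.\<close>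

lemma AE_immortal: "AE \<omega> in Q. \<forall>t\<ge>0. \<omega> t \<noteq> None"
proof -
  interpret prob_space Q by (rule prob_Q)
  have "AE \<omega> in Q. \<omega> (real n) \<noteq> None" for n
  proof -
    let ?A = "{\<omega> \<in> paths. \<omega> (real n) \<in> {None}}"
    have A: "?A \<in> filt (real n)"
    proof -
      have "?A \<in> sigma_X {0..real n}" unfolding sigma_X_def
        by (intro sigma_sets.Basic CollectI exI[of _ "real n"] exI[of _ "{None}"])
          (auto intro: None_in_state_space)
      then show ?thesis using sigma_X_subset_filt by blast
    qed
    have "measure Q ?A = (LINT \<omega>:?A|p. h_density \<phi> l x (real n) \<omega>)"
      by (rule measure_eq) (use A in auto)
    also have "\<dots> = (LINT \<omega>:?A|p. 0)"
      by (rule set_lebesgue_integral_cong) (use A filt_sets density_dead in auto)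
    finally have "measure Q ?A = 0" by (simp add: set_lebesgue_integral_def)
    then have "AE \<omega> in Q. \<omega> \<notin> ?A"
      using A filt_sets by (subst (asm) prob_eq_0) auto
    with AE_space show ?thesis by eventually_elim (auto simp: space_Q)
  qed
  then have "AE \<omega> in Q. \<forall>n::nat. \<omega> (real n) \<noteq> None"
    by (subst AE_all_countable) auto
  with AE_space show ?thesis
  proof eventually_elim
    case (elim \<omega>)
    show ?case
    proof (intro allI impI)
      fix t :: real assume "0 \<le> t"
      obtain n where "t \<le> real n" using real_arch_simple by blast
      with elim \<open>0 \<le> t\<close> show "\<omega> t \<noteq> None"
        using path_alive_before[of \<omega> t "real n"] by (auto simp: space_Q)
    qed
  qed
qed

end

section \<open>The likelihood ratio of two \<open>h\<close>-transforms\<close>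

locale h_transform_pair =
  L: h_transformed p \<phi>1 l1 x Q1 + R: h_transformed p \<phi>2 l2 x Q2
  for p \<phi>1 l1 x Q1 \<phi>2 l2 Q2
begin

interpretation Q1: prob_space Q1 by (rule L.prob_Q)
interpretation Q2: prob_space Q2 by (rule R.prob_Q)

definition ratio :: "real \<Rightarrow> path \<Rightarrow> real" where
  "ratio t \<omega> = h_density \<phi>2 l2 x t \<omega> / h_density \<phi>1 l1 x t \<omega>"

lemma ratio_nonneg: "\<omega> \<in> paths \<Longrightarrow> 0 \<le> t \<Longrightarrow> 0 \<le> ratio t \<omega>"
  unfolding ratio_def by (intro divide_nonneg_nonneg L.density_nonneg R.density_nonneg)

text \<open>Clearing the denominator is harmless even for dead paths, as both densities then vanish.\<close>

lemma ratio_le_iff: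
  assumes "\<omega> \<in> paths" "0 \<le> t" "0 \<le> a"
  shows "ratio t \<omega> \<le> a \<longleftrightarrow> h_density \<phi>2 l2 x t \<omega> \<le> a * h_density \<phi>1 l1 x t \<omega>"
proof (cases "\<omega> t = None")
  case True
  then show ?thesis using assms by (simp add: ratio_def L.density_dead R.density_dead)
next
  case False
  then show ?thesis using L.density_pos[OF assms(1,2)] by (simp add: ratio_def divide_le_eq)
qed

lemma borel_measurable_ratio:
  assumes "t \<in> I" "0 \<le> t"
  shows "ratio t \<in> borel_measurable (sigma paths (sigma_X I))"
  unfolding ratio_def
  by (intro borel_measurable_divide borel_measurable_h_density L.continuous R.continuous assms)

lemma ratio_less_in_sigma_X:
  "t \<in> I \<Longrightarrow> 0 \<le> t \<Longrightarrow> {\<omega> \<in> paths. b < ratio t \<omega>} \<in> sigma_X I"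
  using measurable_sets[OF borel_measurable_ratio[of t I], of "{b<..}"]
  by (simp add: vimage_def Collect_conj_eq[symmetric] conj_commute Int_def)

lemma ratio_less_in_filt: "0 \<le> t \<Longrightarrow> {\<omega> \<in> paths. b < ratio t \<omega>} \<in> filt t"
  using ratio_less_in_sigma_X[of t "{0..t}" b] sigma_X_subset_filt[of t] by auto

lemma filt_Diff: "A \<in> filt t \<Longrightarrow> B \<in> filt t \<Longrightarrow> A - B \<in> filt t"
  using sets.Diff[of A "sigma paths (filt t)" B] by simp

lemma filt_Int: "A \<in> filt t \<Longrightarrow> B \<in> filt t \<Longrightarrow> A \<inter> B \<in> filt t"
  using sets.Int[of A "sigma paths (filt t)" B] by simp

text \<open>On \<open>\<F>\<^sub>t\<close> the ratio is the density of \<open>Q2\<close> with respect to \<open>Q1\<close>, so bounds for the ratio are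
  bounds for one law by the other.\<close>

lemma measure_le:
  assumes "0 \<le> t" "A \<in> filt t" "0 \<le> a" "\<And>\<omega>. \<omega> \<in> A \<Longrightarrow> ratio t \<omega> \<le> a"
  shows "measure Q2 A \<le> a * measure Q1 A"
proof -
  have "measure Q2 A = (LINT \<omega>:A|p. h_density \<phi>2 l2 x t \<omega>)"
    by (rule R.measure_eq[OF assms(1,2)])
  also have "\<dots> \<le> (LINT \<omega>:A|p. a * h_density \<phi>1 l1 x t \<omega>)"
  proof (rule set_integral_mono)
    show "set_integrable p A (h_density \<phi>2 l2 x t)"
      by (rule R.set_integrable_density[OF assms(1,2)])
    show "set_integrable p A (\<lambda>\<omega>. a * h_density \<phi>1 l1 x t \<omega>)"
      by (rule set_integrable_mult_right) (rule L.set_integrable_density[OF assms(1,2)])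
    fix \<omega> assume "\<omega> \<in> A"
    then show "h_density \<phi>2 l2 x t \<omega> \<le> a * h_density \<phi>1 l1 x t \<omega>"
      using ratio_le_iff[of \<omega> t a] assms filt_subset_Pow by blast
  qed
  also have "\<dots> = a * measure Q1 A"
    using L.measure_eq[OF assms(1,2)] by simp
  finally show ?thesis .
qed

lemma measure_ge:
  assumes "0 \<le> t" "A \<in> filt t" "\<And>\<omega>. \<omega> \<in> A \<Longrightarrow> b \<le> ratio t \<omega>"
  shows "b * measure Q1 A \<le> measure Q2 A"
proof -
  have "b * measure Q1 A = (LINT \<omega>:A|p. b * h_density \<phi>1 l1 x t \<omega>)"
    using L.measure_eq[OF assms(1,2)] by simp
  also have "\<dots> \<le> (LINT \<omega>:A|p. h_density \<phi>2 l2 x t \<omega>)"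
  proof (rule set_integral_mono)
    show "set_integrable p A (h_density \<phi>2 l2 x t)"
      by (rule R.set_integrable_density[OF assms(1,2)])
    show "set_integrable p A (\<lambda>\<omega>. b * h_density \<phi>1 l1 x t \<omega>)"
      by (rule set_integrable_mult_right) (rule L.set_integrable_density[OF assms(1,2)])
    fix \<omega> assume "\<omega> \<in> A"
    then have \<omega>: "\<omega> \<in> paths" using assms filt_subset_Pow by blast
    show "b * h_density \<phi>1 l1 x t \<omega> \<le> h_density \<phi>2 l2 x t \<omega>"
    proof (cases "\<omega> t = None")
      case True
      then show ?thesis by (simp add: L.density_dead R.density_dead)
    next
      case False
      then show ?thesis
        using L.density_pos[OF \<omega> assms(1)] assms(3)[OF \<open>\<omega> \<in> A\<close>] by (simp add: ratio_def le_divide_eq)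
    qed
  qed
  also have "\<dots> = measure Q2 A"
    by (rule R.measure_eq[OF assms(1,2), symmetric])
  finally show ?thesis .
qed

text \<open>Doob's maximal inequality: split at the earliest time of \<open>F\<close> at which the ratio exceeds \<open>b\<close>; the
  piece with first passage at \<open>t\<close> is in \<open>\<F>\<^sub>t\<close>, where the ratio is the density. The induction removes
  the earliest time \<open>t\<close> and replaces \<open>A\<close> by the part of \<open>A\<close> without passage at \<open>t\<close>, an event of \<open>\<F>\<^sub>t\<close>;
  this is why \<open>A\<close> and \<open>s\<close> are arbitrary.\<close>

lemma first_passage_finite:
  assumes "finite F" "0 \<le> s" "F \<subseteq> {s<..}" "A \<in> filt s"
  shows "b * measure Q1 (A \<inter> (\<Union>t\<in>F. {\<omega> \<in> paths. b < ratio t \<omega>}))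
    \<le> measure Q2 (A \<inter> (\<Union>t\<in>F. {\<omega> \<in> paths. b < ratio t \<omega>}))"
  using assms
proof (induction F arbitrary: s A rule: finite_linorder_min_induct)
  case empty
  then show ?case by simp
next
  case (insert t F)
  let ?U = "\<lambda>t. {\<omega> \<in> paths. b < ratio t \<omega>}"
  define B where "B = A \<inter> ?U t"
  define C where "C = (A - ?U t) \<inter> (\<Union>t\<in>F. ?U t)"
  have t: "0 \<le> t" "s \<le> t" using insert by auto
  have At: "A \<in> filt t" using insert.prems(3) filt_mono[OF t(2)] by blast
  have Ut: "?U t \<in> filt t" using t by (intro ratio_less_in_filt)
  have B: "B \<in> filt t" unfolding B_def by (rule filt_Int[OF At Ut])
  have "?U u \<in> filt_infinity" if "u \<in> F" for u
    using that insert t ratio_less_in_filt[of u b] filt_subset_filt_infinity by force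
  then have U: "(\<Union>t\<in>F. ?U t) \<in> filt_infinity"
    using insert by (intro sets.finite_UN) auto
  have C: "C \<in> filt_infinity"
    unfolding C_def using U filt_Diff[OF At Ut] filt_subset_filt_infinity by (intro sets.Int) auto
  have eq: "A \<inter> (\<Union>t\<in>insert t F. ?U t) = B \<union> C" unfolding B_def C_def by auto
  have "B \<inter> C = {}" unfolding B_def C_def by auto
  then have m1: "measure Q1 (B \<union> C) = measure Q1 B + measure Q1 C"
    and m2: "measure Q2 (B \<union> C) = measure Q2 B + measure Q2 C"
    using B C L.filt_sets R.filt_sets
    by (auto intro!: Q1.finite_measure_Union Q2.finite_measure_Union simp: L.sets_Q R.sets_Q)
  have "b * measure Q1 B \<le> measure Q2 B"
    by (rule measure_ge[OF t(1) B]) (auto simp: B_def)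
  moreover have "b * measure Q1 C \<le> measure Q2 C"
    unfolding C_def using insert t by (intro insert.IH[of t] filt_Diff[OF At Ut]) auto
  ultimately show ?case unfolding eq m1 m2 by (simp add: algebra_simps)
qed

lemma first_passage:
  assumes "0 \<le> s" "A \<in> filt s"
  shows "b * measure Q1 (A \<inter> (\<Union>t\<in>\<rat> \<inter> {s<..}. {\<omega> \<in> paths. b < ratio t \<omega>})) \<le> measure Q2 A"
proof -
  let ?U = "\<lambda>t. {\<omega> \<in> paths. b < ratio t \<omega>}"
  define D :: "real set" where "D = \<rat> \<inter> {s<..}"
  have D: "countable D" unfolding D_def by (intro countable_Int1 countable_rat)
  have "D \<noteq> {}" unfolding D_def using Rats_dense_in_real[of s "s + 1"] by auto
  then have range: "range (from_nat_into D) = D" using D by (rule range_from_nat_into)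
  define B where "B n = A \<inter> (\<Union>t\<in>from_nat_into D ` {..n}. ?U t)" for n
  have sub: "from_nat_into D ` {..n} \<subseteq> {s<..}" for n
    using range unfolding D_def by blast
  have UB: "(\<Union>t\<in>from_nat_into D ` {..n}. ?U t) \<in> filt_infinity" for n
  proof (rule sets.finite_UN)
    fix u assume "u \<in> from_nat_into D ` {..n}"
    then have "0 \<le> u" using sub[of n] assms(1) by force
    then show "?U u \<in> filt_infinity" using ratio_less_in_filt filt_subset_filt_infinity by blast
  qed simp
  have B: "B n \<in> filt_infinity" for n
    unfolding B_def using assms(2) filt_subset_filt_infinity UB by (intro sets.Int) auto
  have "incseq B" unfolding incseq_def B_def by (auto; meson atMost_iff order_trans)
  have "(\<lambda>n. measure Q1 (B n)) \<longlonglongrightarrow> measure Q1 (\<Union>n. B n)"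
    by (rule Q1.finite_Lim_measure_incseq) (use B \<open>incseq B\<close> L.sets_Q in auto)
  then have lim: "(\<lambda>n. b * measure Q1 (B n)) \<longlonglongrightarrow> b * measure Q1 (\<Union>n. B n)"
    by (rule tendsto_mult_left)
  have "b * measure Q1 (B n) \<le> measure Q2 A" for n
  proof -
    have "b * measure Q1 (B n) \<le> measure Q2 (B n)"
      unfolding B_def by (rule first_passage_finite) (use assms sub in auto)
    also have "\<dots> \<le> measure Q2 A"
      by (rule Q2.finite_measure_mono) (use assms R.filt_sets B_def in auto)
    finally show ?thesis .
  qed
  then have "b * measure Q1 (\<Union>n. B n) \<le> measure Q2 A"
    using lim by (intro LIMSEQ_le_const2) auto
  also have "(\<Union>n. B n) = A \<inter> (\<Union>t\<in>D. ?U t)"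
  proof -
    have "D = (\<Union>n. from_nat_into D ` {..n})"
      using range by (simp add: image_UN[symmetric] UN_atMost_UNIV)
    then have "(\<Union>t\<in>D. ?U t) = (\<Union>n. \<Union>t\<in>from_nat_into D ` {..n}. ?U t)"
      by (metis UN_UN_flatten)
    then show ?thesis unfolding B_def by (simp only: Int_UN_distrib)
  qed
  finally show ?thesis unfolding D_def .
qed

definition exceeds :: "real \<Rightarrow> path set" where
  "exceeds b = {\<omega> \<in> paths. \<forall>n::nat. \<exists>t\<in>\<rat>. real n < t \<and> b < ratio t \<omega>}"

lemma exceeds_in_tail: "exceeds b \<in> tail_sigma"
  unfolding tail_sigma_def
proof (rule INT_I)
  fix T :: real assume "T \<in> {0<..}"
  obtain N where N: "T \<le> real N" using real_arch_simple by blast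
  have U: "(\<Union>t\<in>\<rat> \<inter> {real (n + N)<..}. {\<omega> \<in> paths. b < ratio t \<omega>}) \<in> sigma_X {T<..}" for n
  proof -
    have "(\<Union>t\<in>\<rat> \<inter> {real (n + N)<..}. {\<omega> \<in> paths. b < ratio t \<omega>})
        \<in> sets (sigma paths (sigma_X {T<..}))"
    proof (intro sets.countable_UN' countable_Int1 countable_rat image_subsetI)
      fix t assume "t \<in> \<rat> \<inter> {real (n + N)<..}"
      then show "{\<omega> \<in> paths. b < ratio t \<omega>} \<in> sets (sigma paths (sigma_X {T<..}))"
        using N \<open>T \<in> {0<..}\<close> by (simp add: ratio_less_in_sigma_X)
    qed
    then show ?thesis by simp
  qed
  have "exceeds b = (\<Inter>n. \<Union>t\<in>\<rat> \<inter> {real (n + N)<..}. {\<omega> \<in> paths. b < ratio t \<omega>})"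
  proof (intro equalityI subsetI)
    fix \<omega> assume "\<omega> \<in> exceeds b"
    then show "\<omega> \<in> (\<Inter>n. \<Union>t\<in>\<rat> \<inter> {real (n + N)<..}. {\<omega> \<in> paths. b < ratio t \<omega>})"
      unfolding exceeds_def by blast
  next
    fix \<omega> assume *: "\<omega> \<in> (\<Inter>n. \<Union>t\<in>\<rat> \<inter> {real (n + N)<..}. {\<omega> \<in> paths. b < ratio t \<omega>})"
    have "\<exists>t\<in>\<rat>. real n < t \<and> b < ratio t \<omega>" for n
    proof -
      from * obtain t where "t \<in> \<rat>" "real (n + N) < t" "b < ratio t \<omega>" by blast
      then show ?thesis by (intro bexI[of _ t]) auto
    qed
    with * show "\<omega> \<in> exceeds b" unfolding exceeds_def by blast
  qed
  also have "\<dots> \<in> sets (sigma paths (sigma_X {T<..}))"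
    using U by (intro sets.countable_INT) auto
  finally show "exceeds b \<in> sigma_X {T<..}" by simp
qed

lemma exceeds_sets: "exceeds b \<in> sets Q1"
proof -
  have "exceeds b = (\<Inter>n::nat. \<Union>t\<in>\<rat> \<inter> {real n<..}. {\<omega> \<in> paths. b < ratio t \<omega>})"
    unfolding exceeds_def by blast
  also have "\<dots> \<in> filt_infinity"
  proof (intro sets.countable_INT' sets.countable_UN' countable_Int1 countable_rat image_subsetI)
    fix n :: nat and t assume "t \<in> \<rat> \<inter> {real n<..}"
    then have "0 \<le> t" by (auto intro: order_trans[of 0 "real n"])
    then show "{\<omega> \<in> paths. b < ratio t \<omega>} \<in> filt_infinity"
      using ratio_less_in_filt filt_subset_filt_infinity by blast
  qed auto
  finally show ?thesis using L.sets_Q by simp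
qed

text \<open>The key step. On the event \<open>A\<close> that the ratio is at most \<open>a\<close> at time \<open>s\<close> the density
  gives \<open>Q2 A \<le> a * Q1 A\<close>. Almost every path in \<open>A\<close> exceeds \<open>b\<close> later, so the maximal
  inequality gives \<open>b * Q1 A \<le> Q2 A\<close>. As \<open>a < b\<close>, the event \<open>A\<close> is null.\<close>

lemma AE_ratio_gt_of_exceeds:
  assumes "measure Q1 (exceeds b) = 1" "a < b" "0 \<le> s"
  shows "AE \<omega> in Q1. a < ratio s \<omega>"
proof (cases "a < 0")
  case True
  then show ?thesis
    using ratio_nonneg[OF _ assms(3)] by (intro AE_I2) (force simp: L.space_Q)
next
  case False
  define A where "A = paths - {\<omega> \<in> paths. a < ratio s \<omega>}"
  have "paths \<in> filt s"
    using sets.top[of "sigma paths (filt s)"] by simp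
  then have A: "A \<in> filt s"
    unfolding A_def using assms by (intro filt_Diff ratio_less_in_filt)
  let ?V = "\<Union>t\<in>\<rat> \<inter> {s<..}. {\<omega> \<in> paths. b < ratio t \<omega>}"
  have "AE \<omega> in Q1. \<omega> \<in> exceeds b"
    using assms(1) exceeds_sets by (subst (asm) Q1.prob_eq_1) auto
  then have "measure Q1 A = measure Q1 (A \<inter> ?V)"
  proof (intro Q1.finite_measure_eq_AE)
    assume "AE \<omega> in Q1. \<omega> \<in> exceeds b"
    then show "AE \<omega> in Q1. (\<omega> \<in> A) = (\<omega> \<in> A \<inter> ?V)"
    proof eventually_elim
      case (elim \<omega>)
      obtain n where "s \<le> real n" using real_arch_simple by blast
      moreover obtain t where "t \<in> \<rat>" "real n < t" "b < ratio t \<omega>" "\<omega> \<in> paths"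
        using elim unfolding exceeds_def by blast
      ultimately have "\<omega> \<in> ?V" by auto
      then show ?case by blast
    qed
    show "A \<in> sets Q1" using A L.filt_sets by blast
    have "?V \<in> filt_infinity"
    proof (intro sets.countable_UN' countable_Int1 countable_rat image_subsetI)
      fix t assume "t \<in> \<rat> \<inter> {s<..}"
      then have "0 \<le> t" using assms by auto
      then show "{\<omega> \<in> paths. b < ratio t \<omega>} \<in> filt_infinity"
        using ratio_less_in_filt filt_subset_filt_infinity by blast
    qed
    then show "A \<inter> ?V \<in> sets Q1"
      using \<open>A \<in> sets Q1\<close> L.sets_Q by (intro sets.Int) auto
  qed
  then have "b * measure Q1 A \<le> measure Q2 A" using first_passage[OF assms(3) A, of b] by simp
  also have "measure Q2 A \<le> a * measure Q1 A"
    by (rule measure_le[OF assms(3) A]) (use False A_def in auto)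
  finally have "(b - a) * measure Q1 A \<le> 0" by (simp add: algebra_simps)
  then have "measure Q1 A = 0"
    using assms(2) measure_nonneg[of Q1 A] by (simp add: mult_le_0_iff)
  then have "AE \<omega> in Q1. \<omega> \<notin> A"
    using A L.filt_sets by (subst (asm) Q1.prob_eq_0) auto
  with AE_space show ?thesis by eventually_elim (auto simp: A_def L.space_Q)
qed

lemma ratio_0: "AE \<omega> in Q1. ratio 0 \<omega> = 1"
  using L.start
  by eventually_elim
    (use L.positive[OF L.x_pos] R.positive[OF R.x_pos] in
      \<open>simp add: ratio_def h_density_def ext0_def\<close>)

lemma ratio_closed:
  assumes "\<omega> \<in> paths" "closed C" "0 \<le> t" "\<And>u. u \<in> \<rat> \<Longrightarrow> t < u \<Longrightarrow> ratio u \<omega> \<in> C"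
  shows "ratio t \<omega> \<in> C"
  unfolding ratio_def
  by (rule density_ratio_closed[OF assms(1) L.continuous R.continuous L.positive R.positive L.x_pos])
    (use assms in \<open>auto simp: ratio_def\<close>)

text \<open>By tail triviality the upper limit of the ratio along rational times is a constant \<open>c\<close>. At every fixed
  time the ratio lies above every level below \<open>c\<close>, so it is bounded below by \<open>c\<close> throughout and
  converges to \<open>c\<close>; the value \<open>1\<close> at time \<open>0\<close> forces \<open>c \<le> 1\<close>.\<close>

lemma zero_one_limit:
  assumes triv: "tail_trivial Q1"
  obtains c where "0 \<le> c" "c \<le> 1" "AE \<omega> in Q1. ((\<lambda>t. ratio t \<omega>) \<longlongrightarrow> c) at_top"
    "\<And>s. 0 \<le> s \<Longrightarrow> AE \<omega> in Q1. c \<le> ratio s \<omega>"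
proof -
  define B where "B = {b. measure Q1 (exceeds b) = 1}"
  have neg: "b \<in> B" if "b < 0" for b
  proof -
    have "exceeds b = paths"
    proof -
      have "\<exists>t\<in>\<rat>. real n < t \<and> b < ratio t \<omega>" if "\<omega> \<in> paths" for n \<omega>
      proof -
        obtain t where t: "t \<in> \<rat>" "real n < t" using Rats_dense_in_real[of "real n" "real n + 1"] by auto
        then have "0 \<le> ratio t \<omega>" by (intro ratio_nonneg that) (auto intro: order_trans[of 0 "real n"])
        then show ?thesis using t \<open>b < 0\<close> by (intro bexI[of _ t]) auto
      qed
      then show ?thesis unfolding exceeds_def by blast
    qed
    then show ?thesis unfolding B_def using Q1.prob_space L.space_Q by simp
  qed
  have le1: "b \<le> 1" if "b \<in> B" for b
  proof (rule ccontr)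
    assume "\<not> b \<le> 1"
    then have "AE \<omega> in Q1. 1 < ratio 0 \<omega>"
      using that unfolding B_def by (intro AE_ratio_gt_of_exceeds[of b]) auto
    with ratio_0 have "AE \<omega> in Q1. False" by eventually_elim simp
    then show False by simp
  qed
  define c where "c = Sup B"
  have bdd: "bdd_above B" using le1 by (rule bdd_aboveI)
  have "B \<noteq> {}" using neg[of "-1"] by auto
  have c1: "c \<le> 1" unfolding c_def using \<open>B \<noteq> {}\<close> le1 by (rule cSup_least)
  have c0: "0 \<le> c"
  proof (rule dense_le)
    fix b :: real assume "b < 0"
    then show "b \<le> c" unfolding c_def using bdd neg by (intro cSup_upper)
  qed
  have lower: "AE \<omega> in Q1. c \<le> ratio s \<omega>" if "0 \<le> s" for s
  proof -
    have "AE \<omega> in Q1. c - 1 / real (Suc n) < ratio s \<omega>" for n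
    proof -
      have "c - 1 / real (Suc n) < c" by simp
      then obtain b where b: "b \<in> B" "c - 1 / real (Suc n) < b"
        using less_cSupD[OF \<open>B \<noteq> {}\<close>] unfolding c_def by blast
      then show ?thesis
        using that unfolding B_def by (intro AE_ratio_gt_of_exceeds[of b]) auto
    qed
    then have "AE \<omega> in Q1. \<forall>n. c - 1 / real (Suc n) < ratio s \<omega>"
      by (subst AE_all_countable) auto
    then show ?thesis
    proof eventually_elim
      case (elim \<omega>)
      show ?case
      proof (rule ccontr)
        assume "\<not> c \<le> ratio s \<omega>"
        then obtain n where "1 / real (Suc n) < c - ratio s \<omega>"
          using nat_approx_posE[of "c - ratio s \<omega>"] by auto
        with elim[rule_format, of n] show False by simp
      qed
    qed
  qed
  have "AE \<omega> in Q1. \<forall>u\<in>\<rat> \<inter> {0..}. c \<le> ratio u \<omega>"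
    by (subst AE_ball_countable) (auto intro: countable_Int1 countable_rat lower)
  moreover have "AE \<omega> in Q1. \<forall>n. \<omega> \<notin> exceeds (c + 1 / real (Suc n))"
  proof (subst AE_all_countable, rule allI)
    fix n
    let ?b = "c + 1 / real (Suc n)"
    have "?b \<notin> B"
    proof
      assume "?b \<in> B"
      then have "?b \<le> c" unfolding c_def by (rule cSup_upper[OF _ bdd])
      then show False by simp
    qed
    then have "measure Q1 (exceeds ?b) = 0"
      using triv exceeds_in_tail[of ?b] unfolding tail_trivial_def B_def by auto
    then show "AE \<omega> in Q1. \<omega> \<notin> exceeds ?b"
      using exceeds_sets by (subst (asm) Q1.prob_eq_0) auto
  qed
  ultimately have "AE \<omega> in Q1. ((\<lambda>t. ratio t \<omega>) \<longlongrightarrow> c) at_top"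
    using AE_space
  proof eventually_elim
    case (elim \<omega>)
    then have \<omega>: "\<omega> \<in> paths" by (simp add: L.space_Q)
    show ?case
    proof (rule tendstoI)
      fix e :: real assume "0 < e"
      then obtain k where k: "1 / real (Suc k) < e" using nat_approx_posE by blast
      obtain N :: nat where N: "\<And>u. u \<in> \<rat> \<Longrightarrow> real N < u \<Longrightarrow> ratio u \<omega> \<le> c + 1 / real (Suc k)"
        using elim(2)[rule_format, of k] \<omega> unfolding exceeds_def mem_Collect_eq not_le[symmetric]
        by blast
      show "\<forall>\<^sub>F t in at_top. dist (ratio t \<omega>) c < e"
        unfolding eventually_at_top_linorder
      proof (intro exI allI impI)
        fix t assume t: "real N \<le> t"
        have "ratio t \<omega> \<in> {c .. c + 1 / real (Suc k)}"
        proof (rule ratio_closed[OF \<omega>])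
          show "0 \<le> t" using t by (auto intro: order_trans[of 0 "real N"])
          fix u assume "u \<in> \<rat>" "t < u"
          then show "ratio u \<omega> \<in> {c..c + 1 / real (Suc k)}"
            using elim(1) N[of u] t \<open>0 \<le> t\<close> by auto
        qed simp
        then show "dist (ratio t \<omega>) c < e" using k by (auto simp: dist_real_def)
      qed
    qed
  qed
  with c0 c1 lower show ?thesis by (intro that[of c])
qed

text \<open>Two probabilities of which one dominates the other coincide, by passing to complements, and equal laws
  have equal densities.\<close>

lemma AE_densities_eq:
  assumes dom: "\<And>A. A \<in> filt s \<Longrightarrow> measure Q1 A \<le> measure Q2 A" and "0 \<le> s"
  shows "AE \<omega> in p. h_density \<phi>1 l1 x s \<omega> = h_density \<phi>2 l2 x s \<omega>"
proof -
  let ?d1 = "h_density \<phi>1 l1 x s" and ?d2 = "h_density \<phi>2 l2 x s"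
  have top: "paths \<in> filt s" using sets.top[of "sigma paths (filt s)"] by simp
  have eq: "measure Q1 A = measure Q2 A" if A: "A \<in> filt s" for A
    using dom[OF A] dom[OF filt_Diff[OF top A]]
      Q1.prob_compl[of A] Q2.prob_compl[of A] L.filt_sets(1)[OF A] R.filt_sets(1)[OF A]
    by (simp add: L.space_Q R.space_Q)
  have meas: "{\<omega> \<in> paths. f \<omega> < g \<omega>} \<in> filt s"
    if "f \<in> {?d1, ?d2}" "g \<in> {?d1, ?d2}" for f g :: "path \<Rightarrow> real"
  proof -
    have "f \<in> borel_measurable (sigma paths (sigma_X {0..s}))"
      "g \<in> borel_measurable (sigma paths (sigma_X {0..s}))"
      using that assms(2) borel_measurable_h_density[OF L.continuous, of s "{0..s}"]
        borel_measurable_h_density[OF R.continuous, of s "{0..s}"] by auto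
    from borel_measurable_less[OF this] show ?thesis
      using sigma_X_subset_filt[of s] by auto
  qed
  have 1: "AE \<omega> in p. \<omega> \<notin> {\<omega> \<in> paths. ?d1 \<omega> < ?d2 \<omega>}" (is "AE \<omega> in p. \<omega> \<notin> ?A")
  proof (rule AE_notin_of_set_integral_nonpos)
    have A: "?A \<in> filt s" by (rule meas) auto
    show "?A \<in> sets p" by (rule L.filt_sets(2)[OF A])
    show "integrable p (\<lambda>\<omega>. ?d2 \<omega> - ?d1 \<omega>)"
      using L.integrable_density R.integrable_density assms by (intro Bochner_Integration.integrable_diff)
    show "(LINT \<omega>:?A|p. ?d2 \<omega> - ?d1 \<omega>) \<le> 0"
      using eq[OF A] L.measure_eq[OF assms(2) A] R.measure_eq[OF assms(2) A]
        L.set_integrable_density[OF assms(2) A] R.set_integrable_density[OF assms(2) A]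
      by (subst set_integral_diff) auto
  qed auto
  have 2: "AE \<omega> in p. \<omega> \<notin> {\<omega> \<in> paths. ?d2 \<omega> < ?d1 \<omega>}" (is "AE \<omega> in p. \<omega> \<notin> ?A")
  proof (rule AE_notin_of_set_integral_nonpos)
    have A: "?A \<in> filt s" by (rule meas) auto
    show "?A \<in> sets p" by (rule L.filt_sets(2)[OF A])
    show "integrable p (\<lambda>\<omega>. ?d1 \<omega> - ?d2 \<omega>)"
      using L.integrable_density R.integrable_density assms by (intro Bochner_Integration.integrable_diff)
    show "(LINT \<omega>:?A|p. ?d1 \<omega> - ?d2 \<omega>) \<le> 0"
      using eq[OF A] L.measure_eq[OF assms(2) A] R.measure_eq[OF assms(2) A]
        L.set_integrable_density[OF assms(2) A] R.set_integrable_density[OF assms(2) A]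
      by (subst set_integral_diff) auto
  qed auto
  have "space p = paths" using sets_eq_imp_space_eq[OF L.sets_p] by simp
  then have 3: "AE \<omega> in p. \<omega> \<in> paths" using AE_space[of p] by simp
  show ?thesis using 1 2 3 by eventually_elim auto
qed

text \<open>The densities agree at all times, and at a return to \<open>x\<close> at time \<open>s\<close> the factors from \<open>\<phi>1\<close> and
  \<open>\<phi>2\<close> cancel and leave \<open>exp (l1 * s) = exp (l2 * s)\<close>.\<close>

lemma never_returns_of_dominated:
  assumes dom: "\<And>s A. 0 \<le> s \<Longrightarrow> A \<in> filt s \<Longrightarrow> measure Q1 A \<le> measure Q2 A" and "l1 \<noteq> l2"
  shows "AE \<omega> in p. \<forall>s>0. \<omega> s \<noteq> Some x"
proof -
  have "AE \<omega> in p. \<forall>s\<in>\<rat> \<inter> {0..}. h_density \<phi>1 l1 x s \<omega> = h_density \<phi>2 l2 x s \<omega>"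
    by (subst AE_ball_countable) (auto intro: countable_Int1 countable_rat AE_densities_eq dom)
  moreover have "AE \<omega> in p. \<omega> \<in> paths"
    using AE_space[of p] sets_eq_imp_space_eq[OF L.sets_p] by simp
  ultimately show ?thesis
  proof eventually_elim
    case (elim \<omega>)
    show ?case
    proof (intro allI impI notI)
      fix s :: real assume s: "0 < s" "\<omega> s = Some x"
      have "h_density \<phi>1 l1 x s \<omega> - h_density \<phi>2 l2 x s \<omega> \<in> {0}"
      proof (rule closed_at_alive_time[OF elim(2), where t = s])
        show "continuous_on {t. 0 \<le> t \<and> \<omega> t \<noteq> None}
          (\<lambda>s. h_density \<phi>1 l1 x s \<omega> - h_density \<phi>2 l2 x s \<omega>)"
          using L.positive[OF L.x_pos] R.positive[OF R.x_pos]
          by (intro continuous_on_diff continuous_on_h_density elim L.continuous R.continuous) auto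
      qed (use s elim in auto)
      then have "exp (l1 * s) = exp (l2 * s)"
        using s L.positive[OF L.x_pos] R.positive[OF R.x_pos]
        by (simp add: h_density_def ext0_def)
      then show False using s \<open>l1 \<noteq> l2\<close> by simp
    qed
  qed
qed

text \<open>A limit \<open>1\<close> would be a lower bound for the ratio at every time, so that \<open>Q2\<close> would dominate
  \<open>Q1\<close>; a process that may return to its starting point excludes this.\<close>

lemma limit_less_1:
  assumes triv: "tail_trivial Q1" and "l1 \<noteq> l2"
    and returns: "\<not> (AE \<omega> in p. \<forall>s>0. \<omega> s \<noteq> Some x)"
  obtains c where "0 \<le> c" "c < 1"
    "AE \<omega> in Q1. ((\<lambda>t. h_density \<phi>2 l2 x t \<omega> / h_density \<phi>1 l1 x t \<omega>) \<longlongrightarrow> c) at_top"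
proof -
  obtain c where c: "0 \<le> c" "c \<le> 1" "AE \<omega> in Q1. ((\<lambda>t. ratio t \<omega>) \<longlongrightarrow> c) at_top"
    and lower: "\<And>s. 0 \<le> s \<Longrightarrow> AE \<omega> in Q1. c \<le> ratio s \<omega>"
    using zero_one_limit[OF triv] by blast
  have "c \<noteq> 1"
  proof
    assume "c = 1"
    have "measure Q1 A \<le> measure Q2 A" if s: "0 \<le> s" and A: "A \<in> filt s" for s A
    proof -
      let ?B = "A \<inter> (ratio s -` {1..} \<inter> paths)"
      have "ratio s \<in> borel_measurable (sigma paths (filt s))"
        using s by (intro measurable_sigma_X_filt borel_measurable_ratio) auto
      then have B: "?B \<in> filt s"
        using measurable_sets[of "ratio s" "sigma paths (filt s)" borel "{1..}"]
        by (intro filt_Int[OF A]) simp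
      have "measure Q1 A = measure Q1 ?B"
      proof (rule Q1.finite_measure_eq_AE)
        show "A \<in> sets Q1" "?B \<in> sets Q1" using A B L.filt_sets by blast+
        have "AE \<omega> in Q1. 1 \<le> ratio s \<omega>" using lower[OF s] \<open>c = 1\<close> by simp
        with AE_space show "AE \<omega> in Q1. (\<omega> \<in> A) = (\<omega> \<in> ?B)"
          by eventually_elim (simp add: L.space_Q)
      qed
      also have "1 * measure Q1 ?B \<le> measure Q2 ?B"
        by (rule measure_ge[OF s B]) simp
      also have "measure Q2 ?B \<le> measure Q2 A"
        by (rule Q2.finite_measure_mono) (use A R.filt_sets in auto)
      finally show ?thesis by simp
    qed
    then have "AE \<omega> in p. \<forall>s>0. \<omega> s \<noteq> Some x"
      using \<open>l1 \<noteq> l2\<close> by (rule never_returns_of_dominated)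
    with returns show False by contradiction
  qed
  with c show ?thesis by (intro that[of c]) (auto simp: ratio_def)
qed

end

section \<open>Positivity of the eigenfunctions\<close>

lemma psi_integral_form:
  assumes "psi_equation m q \<psi>" "0 < x"
  defines "g \<equiv> \<lambda>y. LINT z:{0<..y}|m. \<psi> z"
  shows "g integrable_on {0..x}" "\<psi> x = x + q * integral {0..x} g"
proof -
  have *: "set_integrable lborel {0..x} g"
    and eq: "\<psi> x = x + q * (LINT y:{0..x}|lborel. g y)"
    using assms unfolding psi_equation_def g_def by blast+
  show "g integrable_on {0..x}" using set_borel_integral_eq_integral(1)[OF *] .
  show "\<psi> x = x + q * integral {0..x} g"
    using eq set_borel_integral_eq_integral(2)[OF *] by simp
qed

lemma continuous_on_psi:
  assumes "psi_equation m q \<psi>"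
  shows "continuous_on {0<..} \<psi>"
proof (rule continuous_at_imp_continuous_on, rule ballI)
  fix x :: real assume x: "x \<in> {0<..}"
  let ?g = "\<lambda>y. LINT z:{0<..y}|m. \<psi> z"
  have "?g integrable_on {0..x + 1}"
    using psi_integral_form(1)[OF assms, of "x + 1"] x by simp
  then have "continuous_on {0..x + 1} (\<lambda>y. integral {0..y} ?g)"
    by (rule indefinite_integral_continuous_1)
  then have "continuous_on {0<..<x + 1} (\<lambda>y. integral {0..y} ?g)"
    by (rule continuous_on_subset) auto
  then have "continuous_on {0<..<x + 1} (\<lambda>y. y + q * integral {0..y} ?g)"
    by (intro continuous_intros)
  then have "continuous_on {0<..<x + 1} \<psi>"
    by (rule continuous_on_eq) (simp add: psi_integral_form(2)[OF assms])
  then show "isCont \<psi> x"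
    by (rule continuous_on_interior) (use x in simp)
qed

text \<open>With \<open>g y\<close> the \<open>m\<close>-integral of \<open>\<psi>\<close> over \<open>(0,y]\<close>, the function \<open>\<psi> y = y - l * \<integral>\<^sub>0\<^sup>y g\<close> is concave, because
  \<open>g\<close> is nondecreasing for nonnegative \<open>\<psi>\<close>. Suppose that \<open>\<psi>\<close> has a zero \<open>z\<close>. Nonnegativity at \<open>2 z\<close> forces the
  slope of \<open>\<psi>\<close> at \<open>z\<close> to be nonnegative, so \<open>\<psi>\<close> is nondecreasing on \<open>(0,z]\<close> and therefore vanishes there.
  Then \<open>g\<close> vanishes there too, and the equation gives \<open>\<psi> z = z\<close>.\<close>

lemma psi_positive_of_nonneg:
  assumes eq: "psi_equation m (- l) \<psi>" and l: "0 < l" and nn: "\<And>y. 0 < y \<Longrightarrow> 0 \<le> \<psi> y"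
    and "0 < z"
  shows "0 < \<psi> z"
proof (rule ccontr)
  define g where "g y = (LINT z:{0<..y}|m. \<psi> z)" for y
  define G where "G y = integral {0..y} g" for y
  have g_int: "g integrable_on {0..y}" and psi: "\<psi> y = y - l * G y" if "0 < y" for y
    using psi_integral_form[OF eq that] unfolding g_def G_def by simp_all
  have g_mono: "g u \<le> g v" if "0 < u" "u \<le> v" for u v
    unfolding g_def set_lebesgue_integral_def
  proof (rule integral_mono)
    show "integrable m (\<lambda>z. indicat_real {0<..u} z *\<^sub>R \<psi> z)"
      "integrable m (\<lambda>z. indicat_real {0<..v} z *\<^sub>R \<psi> z)"
      using eq that unfolding psi_equation_def set_integrable_def by simp_all
    show "indicat_real {0<..u} z *\<^sub>R \<psi> z \<le> indicat_real {0<..v} z *\<^sub>R \<psi> z" for z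
      using nn[of z] that by (auto simp: indicator_def)
  qed
  have G_diff: "G v - G u = integral {u..v} g" "g integrable_on {u..v}" if "0 < u" "u \<le> v" for u v
  proof -
    have "g integrable_on {0..v}" using that by (intro g_int) simp
    then show "G v - G u = integral {u..v} g" unfolding G_def
      using Henstock_Kurzweil_Integration.integral_combine[of 0 u v g] that by simp
    show "g integrable_on {u..v}"
      by (rule integrable_on_subinterval[OF \<open>g integrable_on {0..v}\<close>]) (use that in auto)
  qed
  assume "\<not> 0 < \<psi> z"
  then have "\<psi> z = 0" using nn[OF \<open>0 < z\<close>] by simp
  then have Gz: "l * G z = z" using psi[OF \<open>0 < z\<close>] by simp
  \<comment> \<open>\<open>1 - l * g z\<close> is the slope of \<open>\<psi>\<close> at \<open>z\<close>.\<close>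
  have "z * g z \<le> G (2 * z) - G z"
  proof -
    have "integral {z..2 * z} (\<lambda>_. g z) \<le> integral {z..2 * z} g"
      by (rule integral_le) (use \<open>0 < z\<close> G_diff g_mono in auto)
    then show ?thesis using \<open>0 < z\<close> G_diff(1)[of z "2 * z"] by simp
  qed
  moreover have "l * G (2 * z) \<le> 2 * z" using psi[of "2 * z"] nn[of "2 * z"] \<open>0 < z\<close> by simp
  ultimately have "l * (z * g z) \<le> z"
    using l Gz by (smt (verit, best) mult_left_mono right_diff_distrib)
  then have gz: "l * g z \<le> 1" using \<open>0 < z\<close> by (simp add: mult.left_commute[of l z])
  have zero: "\<psi> y = 0" if "0 < y" "y \<le> z" for y
  proof -
    have "integral {y..z} g \<le> integral {y..z} (\<lambda>_. g z)"
      by (rule integral_le) (use that G_diff g_mono in auto)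
    then have "G z - G y \<le> (z - y) * g z" using that G_diff(1)[of y z] by simp
    then have "l * (G z - G y) \<le> l * ((z - y) * g z)" using l by (intro mult_left_mono) auto
    also have "\<dots> = (z - y) * (l * g z)" by simp
    also have "\<dots> \<le> (z - y) * 1" using gz that by (intro mult_left_mono) auto
    finally have "l * G z - l * G y \<le> z - y" by (simp add: algebra_simps)
    then have "\<psi> y \<le> 0" using Gz psi[OF that(1)] by simp
    then show ?thesis using nn[OF that(1)] by simp
  qed
  have "g y = 0" if "y \<le> z" for y
  proof -
    have "g y = (LINT z:{0<..y}|m. 0)"
      unfolding g_def set_lebesgue_integral_def
      by (rule Bochner_Integration.integral_cong) (use zero that in \<open>auto simp: indicator_def\<close>)
    then show ?thesis by (simp add: set_lebesgue_integral_def)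
  qed
  then have "G z = integral {0..z} (\<lambda>_. 0)"
    unfolding G_def by (intro Henstock_Kurzweil_Integration.integral_cong) auto
  then show False using Gz \<open>0 < z\<close> by simp
qed

lemma psi_not_nonpos:
  assumes eq: "psi_equation m (- l) \<psi>" and l: "0 < l" and np: "\<And>y. 0 < y \<Longrightarrow> \<psi> y \<le> 0"
  shows False
proof -
  define g where "g y = (LINT z:{0<..y}|m. \<psi> z)" for y
  have "0 \<le> - g y" for y
  proof -
    have "- g y = (LINT z:{0<..y}|m. - \<psi> z)"
      unfolding g_def by (simp add: set_lebesgue_integral_def)
    also have "0 \<le> \<dots>"
      unfolding set_lebesgue_integral_def
      by (rule Bochner_Integration.integral_nonneg) (use np in \<open>auto simp: indicator_def\<close>)
    finally show ?thesis .
  qed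
  then have g_nonpos: "g y \<le> 0" for y by simp
  have "integral {0..1} g \<le> integral {0..1::real} (\<lambda>_. 0)"
  proof (rule integral_le)
    show "g integrable_on {0..1}" using psi_integral_form(1)[OF eq, of 1] unfolding g_def by simp
  qed (use g_nonpos in auto)
  then have "l * integral {0..1} g \<le> 0" using l by (simp add: mult_le_0_iff)
  then show False
    using psi_integral_form(2)[OF eq, of 1] np[of 1] unfolding g_def by simp
qed

lemma psi_positive:
  assumes eq: "psi_equation m (- l) \<psi>" and l: "0 < l"
    and sign: "\<psi> x \<noteq> 0" "\<And>y. 0 < y \<Longrightarrow> 0 \<le> \<psi> y / \<psi> x"
    and "0 < y"
  shows "0 < \<psi> y"
proof (cases "\<psi> x < 0")
  case True
  then have "\<psi> y \<le> 0" if "0 < y" for y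
    using sign(2)[OF that] by (simp add: zero_le_divide_iff)
  then show ?thesis using psi_not_nonpos[OF eq l] by blast
next
  case False
  then have "0 \<le> \<psi> y" if "0 < y" for y
    using sign(1) sign(2)[OF that] by (auto simp: zero_le_divide_iff)
  then show ?thesis using psi_positive_of_nonneg[OF eq l _ \<open>0 < y\<close>] by blast
qed

section \<open>Points visited by the diffusion\<close>

lemma visited_of_hit_finite: "hit y \<omega> < \<infinity> \<Longrightarrow> \<exists>t>0. \<omega> t = Some y"
proof (rule ccontr)
  assume "hit y \<omega> < \<infinity>" "\<not> (\<exists>t>0. \<omega> t = Some y)"
  moreover from this(2) have "{ennreal t | t. 0 < t \<and> \<omega> t = Some y} = {}" by auto
  ultimately show False unfolding hit_def by simp
qed

lemma path_intermediate_value: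
  assumes \<omega>: "\<omega> \<in> paths" and "0 < s" "\<omega> s = Some a" "0 < t" "\<omega> t = Some b" "a \<le> x" "x \<le> b"
  shows "\<exists>u>0. \<omega> u = Some x"
proof -
  have alive: "\<omega> u \<noteq> None" if "min s t \<le> u" "u \<le> max s t" for u
    using path_alive_before[OF \<omega>, of u "max s t"] that assms(2-5) by (auto simp: max_def min_def split: if_splits)
  have cont: "continuous_on {min s t..max s t} (\<lambda>u. the (\<omega> u))"
    by (rule continuous_on_subset[OF continuous_on_path[OF \<omega>]])
      (use alive assms(2,4) in auto)
  have "\<exists>u. min s t \<le> u \<and> u \<le> max s t \<and> the (\<omega> u) = x"
  proof (cases "s \<le> t")
    case True
    then show ?thesis using IVT'[of "\<lambda>u. the (\<omega> u)" s x t] cont assms by auto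
  next
    case False
    then show ?thesis using IVT2'[of "\<lambda>u. the (\<omega> u)" s x t] cont assms by (auto simp: min_def max_def)
  qed
  then obtain u where u: "min s t \<le> u" "u \<le> max s t" "the (\<omega> u) = x" by blast
  then have "0 < u" "\<omega> u = Some x" using alive[of u] assms(2,4) by auto
  then show ?thesis by blast
qed

locale diffusion_start =
  fixes m :: "real measure" and P :: "real \<Rightarrow> path measure" and x :: real
  assumes diffusion: "natural_scale_diffusion m P" and x_pos: "0 < x"
begin

lemma P_space: "P x \<in> space (prob_algebra path_measurable)"
proof -
  have "P \<in> restrict_space borel {0<..} \<rightarrow>\<^sub>M prob_algebra path_measurable"
    using diffusion unfolding natural_scale_diffusion_def by blast
  then show ?thesis by (rule measurable_space) (simp add: space_restrict_space x_pos)
qed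

lemma prob_P: "prob_space (P x)" and sets_P: "sets (P x) = filt_infinity"
  using P_space by (simp_all add: space_prob_algebra)

sublocale prob_space "P x" by (rule prob_P)

lemma space_P: "space (P x) = paths"
  using sets_eq_imp_space_eq[OF sets_P] by simp

lemma AE_start: "AE \<omega> in P x. \<omega> 0 = Some x"
proof -
  have *: "prob {\<omega> \<in> paths. \<omega> 0 = Some x} = 1"
    using diffusion x_pos unfolding natural_scale_diffusion_def by blast
  then have "{\<omega> \<in> paths. \<omega> 0 = Some x} \<in> sets (P x)"
    using measure_notin_sets by fastforce
  then show ?thesis using * prob_eq_1[of "{\<omega> \<in> paths. \<omega> 0 = Some x}"] by auto
qed

text \<open>The probability of hitting \<open>b\<close> before \<open>c\<close> increases strictly as \<open>c\<close> decreases from \<open>a\<close> to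
  \<open>a / 2\<close>. The additional paths hit \<open>b\<close>, but not before \<open>a\<close>, so they visit both points.\<close>

lemma visits_both_sides:
  assumes "0 < a" "a < x" "x < b"
  shows "\<not> (AE \<omega> in P x. \<not> ((\<exists>t>0. \<omega> t = Some a) \<and> (\<exists>t>0. \<omega> t = Some b)))"
proof
  assume never: "AE \<omega> in P x. \<not> ((\<exists>t>0. \<omega> t = Some a) \<and> (\<exists>t>0. \<omega> t = Some b))"
  define E where "E c = {\<omega> \<in> paths. hit b \<omega> < hit c \<omega>}" for c
  have prob_E: "prob (E c) = (x - c) / (b - c)" if "0 < c" "c < x" for c
    using diffusion assms that unfolding natural_scale_diffusion_def E_def by blast
  have E: "E c \<in> sets (P x)" if "0 < c" "c < x" for c
    using prob_E[OF that] that assms measure_notin_sets[of "E c" "P x"] by fastforce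
  \<comment> \<open>If almost no path visits both points, then lowering the lower barrier gains nothing.\<close>
  have a2: "0 < a / 2" "a / 2 < x" using assms by auto
  have "prob (E (a / 2)) \<le> prob (E a)"
  proof (rule finite_measure_mono_AE)
    from never show "AE \<omega> in P x. \<omega> \<in> E (a / 2) \<longrightarrow> \<omega> \<in> E a"
    proof eventually_elim
      case (elim \<omega>)
      show ?case
      proof (intro impI, rule ccontr)
        assume "\<omega> \<in> E (a / 2)" "\<omega> \<notin> E a"
        then have "hit b \<omega> < hit (a / 2) \<omega>" "hit a \<omega> \<le> hit b \<omega>"
          by (auto simp: E_def)
        then have "hit b \<omega> < \<infinity>" "hit a \<omega> < \<infinity>"
          by (auto intro: less_le_trans le_less_trans)
        then show False using elim visited_of_hit_finite by blast
      qed
    qed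
  qed (use E assms in auto)
  then have "(x - a / 2) / (b - a / 2) \<le> (x - a) / (b - a)"
    using prob_E[OF a2] prob_E[of a] assms by simp
  then have "(x - a / 2) / (b - a / 2) * ((b - a / 2) * (b - a)) \<le> (x - a) / (b - a) * ((b - a / 2) * (b - a))"
    using assms by (intro mult_right_mono) auto
  then have "(x - a / 2) * (b - a) \<le> (x - a) * (b - a / 2)"
    using assms by simp
  moreover have "(x - a / 2) * (b - a) - (x - a) * (b - a / 2) = a * (b - x) / 2"
    by (simp add: field_simps)
  ultimately have "a * (b - x) \<le> 0" by linarith
  then show False using assms by (simp add: mult_le_0_iff)
qed

lemma visits:
  assumes "0 < y" "y \<noteq> x"
  shows "\<not> (AE \<omega> in P x. \<not> (\<exists>t>0. \<omega> t = Some y))"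
proof
  assume never: "AE \<omega> in P x. \<not> (\<exists>t>0. \<omega> t = Some y)"
  show False
  proof (cases "y < x")
    case True
    from never have "AE \<omega> in P x. \<not> ((\<exists>t>0. \<omega> t = Some y) \<and> (\<exists>t>0. \<omega> t = Some (x + 1)))"
      by eventually_elim blast
    then show False using visits_both_sides[of y "x + 1"] True assms by simp
  next
    case False
    from never have "AE \<omega> in P x. \<not> ((\<exists>t>0. \<omega> t = Some (x / 2)) \<and> (\<exists>t>0. \<omega> t = Some y))"
      by eventually_elim blast
    then show False using visits_both_sides[of "x / 2" y] False assms x_pos by simp
  qed
qed

lemma returns: "\<not> (AE \<omega> in P x. \<forall>s>0. \<omega> s \<noteq> Some x)"
proof
  assume "AE \<omega> in P x. \<forall>s>0. \<omega> s \<noteq> Some x"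
  with AE_space have "AE \<omega> in P x. \<not> ((\<exists>t>0. \<omega> t = Some (x / 2)) \<and> (\<exists>t>0. \<omega> t = Some (x + 1)))"
  proof eventually_elim
    case (elim \<omega>)
    show ?case
    proof
      assume "(\<exists>t>0. \<omega> t = Some (x / 2)) \<and> (\<exists>t>0. \<omega> t = Some (x + 1))"
      then obtain s t where "0 < s" "\<omega> s = Some (x / 2)" "0 < t" "\<omega> t = Some (x + 1)" by blast
      then have "\<exists>u>0. \<omega> u = Some x"
        using path_intermediate_value[of \<omega> s "x / 2" t "x + 1" x] elim x_pos by (simp add: space_P)
      with elim show False by blast
    qed
  qed
  then show False using visits_both_sides[of "x / 2" "x + 1"] x_pos by simp
qed

end

section \<open>Existing \<open>h\<close>-transforms have positive eigenfunctions\<close>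

context diffusion_start
begin

context
  fixes \<psi> :: "real \<Rightarrow> real" and l :: real and Q :: "path measure"
  assumes cont: "continuous_on {0<..} \<psi>" and law: "h_transform_law P \<psi> l x Q"
begin

lemma prob_space_law: "prob_space Q" and sets_law: "sets Q = filt_infinity"
  using law unfolding h_transform_law_def by auto

lemma measurable_density_P: "0 \<le> t \<Longrightarrow> h_density \<psi> l x t \<in> borel_measurable (P x)"
  using measurable_filt_infinity[OF measurable_sigma_X_filt[OF borel_measurable_h_density[OF cont]], of t t]
  by (simp add: measurable_cong_sets[OF sets_P refl])

lemma paths_in_filt: "paths \<in> filt t"
  using sets.top[of "sigma paths (filt t)"] by simp

lemma integral_over_paths: "(LINT \<omega>:paths|P x. f \<omega>) = (LINT \<omega>|P x. f \<omega> :: real)"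
  unfolding set_lebesgue_integral_def
  by (rule Bochner_Integration.integral_cong) (auto simp: space_P)

lemma integrable_M_process: "0 \<le> t \<Longrightarrow> integrable (P x) (M_process \<psi> l t)"
proof (rule ccontr)
  assume t: "0 \<le> t" and "\<not> integrable (P x) (M_process \<psi> l t)"
  then have "(LINT \<omega>:paths|P x. M_process \<psi> l t \<omega>) = 0"
    unfolding integral_over_paths by (intro not_integrable_integral_eq)
  moreover have "measure Q paths = 1"
    using prob_space.prob_space[OF prob_space_law] sets_eq_imp_space_eq[OF sets_law] by simp
  ultimately show False
    using law t paths_in_filt unfolding h_transform_law_def by auto
qed

lemma integrable_h_density:
  assumes t: "0 \<le> t"
  shows "integrable (P x) (h_density \<psi> l x t)"
proof -
  have "AE \<omega> in P x. M_process \<psi> l t \<omega> = h_density \<psi> l x t \<omega>"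
    using AE_start by eventually_elim (rule M_process_eq_h_density)
  then show ?thesis
    using integrable_M_process[OF t] integrable_cong_AE[OF _ measurable_density_P[OF t]]
      borel_measurable_integrable by blast
qed

lemma measure_law_eq:
  assumes t: "0 \<le> t" and A: "A \<in> filt t"
  shows "measure Q A = (LINT \<omega>:A|P x. h_density \<psi> l x t \<omega>)"
proof -
  have "A \<in> sets (P x)" using A filt_subset_filt_infinity[of t] sets_P by blast
  have "measure Q A = (LINT \<omega>:A|P x. M_process \<psi> l t \<omega>)"
    using law t A unfolding h_transform_law_def by blast
  also have "\<dots> = (LINT \<omega>:A|P x. h_density \<psi> l x t \<omega>)"
    unfolding set_lebesgue_integral_def
  proof (rule integral_cong_AE)
    show "(\<lambda>\<omega>. indicat_real A \<omega> *\<^sub>R M_process \<psi> l t \<omega>) \<in> borel_measurable (P x)"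
      using integrable_M_process[OF t] \<open>A \<in> sets (P x)\<close> by auto
    show "(\<lambda>\<omega>. indicat_real A \<omega> *\<^sub>R h_density \<psi> l x t \<omega>) \<in> borel_measurable (P x)"
      using measurable_density_P[OF t] \<open>A \<in> sets (P x)\<close> by auto
    show "AE \<omega> in P x. indicat_real A \<omega> *\<^sub>R M_process \<psi> l t \<omega> = indicat_real A \<omega> *\<^sub>R h_density \<psi> l x t \<omega>"
      using AE_start by eventually_elim (simp add: M_process_eq_h_density)
  qed
  finally show ?thesis .
qed

lemma total_mass: "(LINT \<omega>|P x. h_density \<psi> l x 0 \<omega>) = 1"
  using measure_law_eq[OF order_refl paths_in_filt] prob_space.prob_space[OF prob_space_law]
    sets_eq_imp_space_eq[OF sets_law] by (simp add: integral_over_paths)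

text \<open>Division by \<open>\<psi> x = 0\<close> would make the density vanish identically.\<close>

lemma eigenfunction_nonzero: "\<psi> x \<noteq> 0"
  using total_mass by (auto simp: h_density_def)

text \<open>Its integrals over the events of \<open>\<F>\<^sub>t\<close> are the probabilities \<open>Q A\<close>.\<close>

lemma AE_density_nonneg:
  assumes t: "0 \<le> t"
  shows "AE \<omega> in P x. 0 \<le> h_density \<psi> l x t \<omega>"
proof -
  let ?A = "h_density \<psi> l x t -` {..<0} \<inter> paths"
  have "h_density \<psi> l x t \<in> borel_measurable (sigma paths (filt t))"
    using t by (intro measurable_sigma_X_filt borel_measurable_h_density cont) auto
  then have A: "?A \<in> filt t"
    using measurable_sets[of "h_density \<psi> l x t" "sigma paths (filt t)" borel "{..<0}"] by simp
  have "AE \<omega> in P x. \<omega> \<notin> ?A"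
  proof (rule AE_notin_of_set_integral_nonpos)
    show "integrable (P x) (\<lambda>\<omega>. - h_density \<psi> l x t \<omega>)" using integrable_h_density[OF t] by simp
    show "?A \<in> sets (P x)" using A filt_subset_filt_infinity[of t] sets_P by blast
    have "(LINT \<omega>:?A|P x. - h_density \<psi> l x t \<omega>) = - measure Q ?A"
      unfolding measure_law_eq[OF t A] by (simp add: set_lebesgue_integral_def)
    then show "(LINT \<omega>:?A|P x. - h_density \<psi> l x t \<omega>) \<le> 0" by simp
  qed auto
  with AE_space show ?thesis by eventually_elim (auto simp: space_P)
qed

text \<open>The density is nonnegative along almost every path and, with positive probability, the path visits
  \<open>y\<close>, where the sign of the density is that of \<open>\<psi> y / \<psi> x\<close>.\<close>

lemma eigenfunction_sign:
  assumes "0 < y"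
  shows "0 \<le> \<psi> y / \<psi> x"
proof (rule ccontr)
  assume neg: "\<not> 0 \<le> \<psi> y / \<psi> x"
  then have "y \<noteq> x" using eigenfunction_nonzero by auto
  have "AE \<omega> in P x. \<forall>t\<in>\<rat> \<inter> {0..}. 0 \<le> h_density \<psi> l x t \<omega>"
    by (subst AE_ball_countable) (auto intro: countable_Int1 countable_rat AE_density_nonneg)
  with AE_space have "AE \<omega> in P x. \<not> (\<exists>t>0. \<omega> t = Some y)"
  proof eventually_elim
    case (elim \<omega>)
    then have \<omega>: "\<omega> \<in> paths" by (simp add: space_P)
    show ?case
    proof
      assume "\<exists>t>0. \<omega> t = Some y"
      then obtain t where t: "0 < t" "\<omega> t = Some y" by blast
      have "h_density \<psi> l x t \<omega> \<in> {0..}"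
      proof (rule closed_at_alive_time[OF \<omega> continuous_on_h_density[OF \<omega> cont eigenfunction_nonzero], where t = t])
        fix u :: real assume "u \<in> \<rat>" "t < u" "\<omega> u \<noteq> None"
        then show "h_density \<psi> l x u \<omega> \<in> {0..}" using elim t by auto
      qed (use t in auto)
      then have "0 \<le> exp (l * t) * (\<psi> y / \<psi> x)"
        using t by (simp add: h_density_def ext0_def del: times_divide_eq_right)
      then show False using neg by (simp only: zero_le_mult_iff) (simp add: not_le)
    qed
  qed
  with visits[OF assms \<open>y \<noteq> x\<close>] show False by blast
qed

lemma AE_law_start: "AE \<omega> in Q. \<omega> 0 = Some x"
proof -
  let ?A = "{\<omega> \<in> paths. \<omega> 0 \<in> {Some x}}"
  have "{Some x} \<in> sets state_space"
    using Some_image_in_state_space[of "{x}"] x_pos by simp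
  then have "?A \<in> sigma_X {0..0}"
    unfolding sigma_X_def
    by (intro sigma_sets.Basic CollectI exI[of _ "0::real"] exI[of _ "{Some x}"]) auto
  then have A: "?A \<in> filt 0" using sigma_X_subset_filt[of 0] by blast
  then have AQ: "?A \<in> sets Q" and AP: "?A \<in> sets (P x)"
    using filt_subset_filt_infinity[of 0] sets_law sets_P by blast+
  have "measure Q ?A = (LINT \<omega>:?A|P x. h_density \<psi> l x 0 \<omega>)"
    by (rule measure_law_eq[OF order_refl A])
  also have "\<dots> = (LINT \<omega>|P x. h_density \<psi> l x 0 \<omega>)"
    unfolding set_lebesgue_integral_def
  proof (rule integral_cong_AE)
    show "(\<lambda>\<omega>. indicat_real ?A \<omega> *\<^sub>R h_density \<psi> l x 0 \<omega>) \<in> borel_measurable (P x)"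
      using measurable_density_P[OF order_refl] AP by auto
    show "AE \<omega> in P x. indicat_real ?A \<omega> *\<^sub>R h_density \<psi> l x 0 \<omega> = h_density \<psi> l x 0 \<omega>"
      using AE_start AE_space by eventually_elim (simp add: space_P)
  qed (rule measurable_density_P[OF order_refl])
  finally have "measure Q ?A = 1" using total_mass by simp
  then have "AE \<omega> in Q. \<omega> \<in> ?A"
    using prob_space.prob_eq_1[OF prob_space_law AQ] by simp
  then show ?thesis by eventually_elim simp
qed

end

lemma h_transformed_of_eigenfunction:
  assumes eq: "psi_equation m (- l) \<psi>" and "0 < l" and law: "h_transform_law P \<psi> l x Q"
  shows "h_transformed (P x) \<psi> l x Q"
proof -
  note cont = continuous_on_psi[OF eq]
  show ?thesis
  proof (rule h_transformed.intro)
    show "0 < \<psi> y" if "0 < y" for y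
      by (rule psi_positive[OF eq \<open>0 < l\<close> eigenfunction_nonzero[OF cont law]
          eigenfunction_sign[OF cont law] that])
  qed (rule sets_P x_pos cont prob_space_law[OF cont law] sets_law[OF cont law]
      integrable_h_density[OF cont law] measure_law_eq[OF cont law] AE_law_start[OF cont law]
      | assumption)+
qed

end

section \<open>Measurability of limit events\<close>

lemma eventually_closed_iff_rational:
  fixes f :: "real \<Rightarrow> path \<Rightarrow> real"
  assumes "\<And>t. 0 \<le> t \<Longrightarrow> (\<And>u. u \<in> \<rat> \<Longrightarrow> t < u \<Longrightarrow> f u \<omega> \<in> C) \<Longrightarrow> f t \<omega> \<in> C"
  shows "(\<forall>\<^sub>F t in at_top. f t \<omega> \<in> C) \<longleftrightarrow> (\<exists>n::nat. \<forall>t\<in>\<rat> \<inter> {real n<..}. f t \<omega> \<in> C)"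
proof
  assume "\<forall>\<^sub>F t in at_top. f t \<omega> \<in> C"
  then obtain N where N: "\<And>t. N \<le> t \<Longrightarrow> f t \<omega> \<in> C" unfolding eventually_at_top_linorder by blast
  obtain n where "N \<le> real n" using real_arch_simple by blast
  then show "\<exists>n::nat. \<forall>t\<in>\<rat> \<inter> {real n<..}. f t \<omega> \<in> C"
    by (intro exI[of _ n] ballI N) auto
next
  assume "\<exists>n::nat. \<forall>t\<in>\<rat> \<inter> {real n<..}. f t \<omega> \<in> C"
  then obtain n :: nat where n: "\<And>t. t \<in> \<rat> \<Longrightarrow> real n < t \<Longrightarrow> f t \<omega> \<in> C" by auto
  have "f t \<omega> \<in> C" if "real n \<le> t" for t
    by (rule assms) (use that n in \<open>auto intro: order_trans[of 0 "real n"]\<close>)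
  then show "\<forall>\<^sub>F t in at_top. f t \<omega> \<in> C" unfolding eventually_at_top_linorder by blast
qed

text \<open>Closed conditions at all late times reduce to rational times, which leaves countably many set
  operations.\<close>

lemma eventually_closed_event:
  fixes f :: "real \<Rightarrow> path \<Rightarrow> real"
  assumes meas: "\<And>t. 0 \<le> t \<Longrightarrow> f t \<in> borel_measurable path_measurable"
    and closed: "\<And>\<omega> C t. \<omega> \<in> paths \<Longrightarrow> closed C \<Longrightarrow> 0 \<le> t \<Longrightarrow>
      (\<And>u. u \<in> \<rat> \<Longrightarrow> t < u \<Longrightarrow> f u \<omega> \<in> C) \<Longrightarrow> f t \<omega> \<in> C"
    and C: "\<And>k::nat. closed (C k)"
  shows "{\<omega> \<in> paths. \<forall>k. \<forall>\<^sub>F t in at_top. f t \<omega> \<in> C k} \<in> filt_infinity"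
proof -
  have "(\<forall>\<^sub>F t in at_top. f t \<omega> \<in> C k) \<longleftrightarrow> (\<exists>n::nat. \<forall>t\<in>\<rat> \<inter> {real n<..}. f t \<omega> \<in> C k)"
    if "\<omega> \<in> paths" for \<omega> k
    by (rule eventually_closed_iff_rational) (rule closed[OF that C])
  then have "{\<omega> \<in> paths. \<forall>k. \<forall>\<^sub>F t in at_top. f t \<omega> \<in> C k}
      = {\<omega> \<in> paths. \<forall>k. \<exists>n::nat. \<forall>t\<in>\<rat> \<inter> {real n<..}. f t \<omega> \<in> C k}"
    by (intro Collect_cong conj_cong refl all_cong1)
  also have "\<dots> = (\<Inter>k. \<Union>n::nat. \<Inter>t\<in>\<rat> \<inter> {real n<..}. f t -` C k \<inter> paths)"
    (is "?L = ?R")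
  proof (intro equalityI subsetI)
    fix \<omega> assume \<omega>: "\<omega> \<in> ?R"
    obtain n where "\<omega> \<in> (\<Inter>t\<in>\<rat> \<inter> {real n<..}. f t -` C 0 \<inter> paths)" using \<omega> by blast
    moreover obtain t where "t \<in> \<rat> \<inter> {real n<..}"
      using Rats_dense_in_real[of "real n" "real n + 1"] by auto
    ultimately have "\<omega> \<in> paths" by blast
    moreover have "\<exists>n::nat. \<forall>t\<in>\<rat> \<inter> {real n<..}. f t \<omega> \<in> C k" for k using \<omega> by blast
    ultimately show "\<omega> \<in> ?L" by blast
  qed blast
  also have "\<dots> \<in> filt_infinity"
  proof (intro sets.countable_INT sets.countable_UN image_subsetI UNIV_not_empty)
    fix k n :: nat
    show "(\<Inter>t\<in>\<rat> \<inter> {real n<..}. f t -` C k \<inter> paths) \<in> filt_infinity"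
    proof (rule sets.countable_INT')
      show "\<rat> \<inter> {real n<..} \<noteq> {}"
        using Rats_dense_in_real[of "real n" "real n + 1"] by auto
      show "countable (\<rat> \<inter> {real n<..})" by (intro countable_Int1 countable_rat)
      show "(\<lambda>t. f t -` C k \<inter> paths) ` (\<rat> \<inter> {real n<..}) \<subseteq> filt_infinity"
      proof (rule image_subsetI)
        fix t assume "t \<in> \<rat> \<inter> {real n<..}"
        then have "0 \<le> t" by (auto intro: order_trans[of 0 "real n"])
        show "f t -` C k \<inter> paths \<in> filt_infinity"
          using measurable_sets[OF meas[OF \<open>0 \<le> t\<close>], of "C k"] C[of k] by (simp add: borel_closed)
      qed
    qed
  qed
  finally show ?thesis .
qed

text \<open>An almost sure limit gives the limit event probability one only if the event itself is
  measurable, which concerns all paths, the dying ones included.\<close>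

lemma limit_event:
  fixes f :: "real \<Rightarrow> path \<Rightarrow> real"
  assumes meas: "\<And>t. 0 \<le> t \<Longrightarrow> f t \<in> borel_measurable path_measurable"
    and closed: "\<And>\<omega> C t. \<omega> \<in> paths \<Longrightarrow> closed C \<Longrightarrow> 0 \<le> t \<Longrightarrow>
      (\<And>u. u \<in> \<rat> \<Longrightarrow> t < u \<Longrightarrow> f u \<omega> \<in> C) \<Longrightarrow> f t \<omega> \<in> C"
    and c: "c \<noteq> - \<infinity>"
  shows "{\<omega> \<in> paths. ((\<lambda>t. ereal (f t \<omega>)) \<longlongrightarrow> c) at_top} \<in> filt_infinity"
proof (cases c)
  case (real r)
  have "((\<lambda>t. ereal (f t \<omega>)) \<longlongrightarrow> c) at_top
      \<longleftrightarrow> (\<forall>k. \<forall>\<^sub>F t in at_top. f t \<omega> \<in> cball r (1 / real (Suc k)))" for \<omega>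
  proof -
    have "((\<lambda>t. f t \<omega>) \<longlongrightarrow> r) at_top
      \<longleftrightarrow> (\<forall>k. \<forall>\<^sub>F t in at_top. f t \<omega> \<in> cball r (1 / real (Suc k)))"
    proof (intro iffI allI)
      fix k assume "((\<lambda>t. f t \<omega>) \<longlongrightarrow> r) at_top"
      then have "\<forall>\<^sub>F t in at_top. dist (f t \<omega>) r < 1 / real (Suc k)"
        by (rule tendstoD) simp
      then show "\<forall>\<^sub>F t in at_top. f t \<omega> \<in> cball r (1 / real (Suc k))"
        by eventually_elim (simp add: dist_commute)
    next
      assume *: "\<forall>k. \<forall>\<^sub>F t in at_top. f t \<omega> \<in> cball r (1 / real (Suc k))"
      show "((\<lambda>t. f t \<omega>) \<longlongrightarrow> r) at_top"
      proof (rule tendstoI)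
        fix e :: real assume "0 < e"
        then obtain k where "1 / real (Suc k) < e" using nat_approx_posE by blast
        with *[rule_format, of k] show "\<forall>\<^sub>F t in at_top. dist (f t \<omega>) r < e"
          by (auto simp: dist_commute elim!: eventually_mono)
      qed
    qed
    then show ?thesis unfolding real by simp
  qed
  then show ?thesis
    by (simp only:) (rule eventually_closed_event[OF meas closed closed_cball])
next
  case PInf
  have "((\<lambda>t. ereal (f t \<omega>)) \<longlongrightarrow> c) at_top
      \<longleftrightarrow> (\<forall>k. \<forall>\<^sub>F t in at_top. f t \<omega> \<in> {real k..})" for \<omega>
    unfolding PInf tendsto_PInfty
  proof (intro iffI allI)
    fix k assume "\<forall>r. \<forall>\<^sub>F t in at_top. ereal r < ereal (f t \<omega>)"
    then have "\<forall>\<^sub>F t in at_top. ereal (real k) < ereal (f t \<omega>)" by blast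
    then show "\<forall>\<^sub>F t in at_top. f t \<omega> \<in> {real k..}" by eventually_elim simp
  next
    fix r assume *: "\<forall>k. \<forall>\<^sub>F t in at_top. f t \<omega> \<in> {real k..}"
    obtain k where "r < real k" using reals_Archimedean2 by blast
    with *[rule_format, of k] show "\<forall>\<^sub>F t in at_top. ereal r < ereal (f t \<omega>)"
      by (auto elim!: eventually_mono)
  qed
  then show ?thesis
    by (simp only:) (rule eventually_closed_event[OF meas closed closed_atLeast])
qed (use c in simp)

lemma measurable_M_process:
  assumes "continuous_on {0<..} \<phi>" "0 \<le> t"
  shows "M_process \<phi> l t \<in> borel_measurable path_measurable"
proof -
  have "M_process \<phi> l t \<in> borel_measurable (sigma paths (sigma_X {0..t}))"
    unfolding M_process_def
    by (intro borel_measurable_times borel_measurable_divide borel_measurable_const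
        borel_measurable_ext0_coordinate) (use assms in auto)
  then show ?thesis by (intro measurable_filt_infinity measurable_sigma_X_filt)
qed

lemma M_ratio_limit_event:
  assumes cont: "continuous_on {0<..} \<phi>1" "continuous_on {0<..} \<phi>2"
    and pos: "\<And>y. 0 < y \<Longrightarrow> 0 < \<phi>1 y" "\<And>y. 0 < y \<Longrightarrow> 0 < \<phi>2 y" and c: "c \<noteq> - \<infinity>"
  shows "{\<omega> \<in> paths. ((\<lambda>t. ereal (M_process \<phi>2 l2 t \<omega> / M_process \<phi>1 l1 t \<omega>)) \<longlongrightarrow> c) at_top}
    \<in> filt_infinity"
proof (rule limit_event[OF _ _ c])
  show "(\<lambda>\<omega>. M_process \<phi>2 l2 t \<omega> / M_process \<phi>1 l1 t \<omega>) \<in> borel_measurable path_measurable"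
    if "0 \<le> t" for t
    by (intro borel_measurable_divide measurable_M_process cont that)
  fix \<omega> C and t :: real
  assume \<omega>: "\<omega> \<in> paths" and "closed C" "0 \<le> t"
    and C: "\<And>u. u \<in> \<rat> \<Longrightarrow> t < u \<Longrightarrow> M_process \<phi>2 l2 u \<omega> / M_process \<phi>1 l1 u \<omega> \<in> C"
  show "M_process \<phi>2 l2 t \<omega> / M_process \<phi>1 l1 t \<omega> \<in> C"
  proof (cases "\<omega> 0")
    case None
    obtain u where "u \<in> \<rat>" "t < u" using Rats_dense_in_real[of t "t + 1"] by auto
    from C[OF this] None show ?thesis by (simp add: M_process_def ext0_def)
  next
    case (Some z)
    then have z: "0 < z" using path_range[OF \<omega>, of 0] by simp
    have M: "M_process \<phi> l u \<omega> = h_density \<phi> l z u \<omega>" for \<phi> l u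
      using Some by (simp add: M_process_def h_density_def ext0_def)
    show ?thesis
      using density_ratio_closed[OF \<omega> cont pos z \<open>closed C\<close> \<open>0 \<le> t\<close>] C unfolding M by blast
  qed
qed

section \<open>Singularity\<close>

theorem theorem6p5:
  fixes m :: "real measure" and P :: "real \<Rightarrow> path measure"
    and \<psi> :: "real \<Rightarrow> real \<Rightarrow> real" and lam mu x :: real
    and Qlam Qmu :: "path measure"
  assumes "radon_full_support m"
    and "natural_scale_diffusion m P"
    and "zero_regular_or_exit m"
    and "infinity_natural m"
    and "\<And>q. psi_equation m q (\<psi> q)"
    and "0 < lambda0 m P"
    and "lam \<in> {0<..lambda0 m P}" and "mu \<in> {0<..lambda0 m P}" and "lam \<noteq> mu"
    and "0 < x"
    and "h_transform_law P (\<psi> (- lam)) lam x Qlam"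
    and "h_transform_law P (\<psi> (- mu)) mu x Qmu"
    and "tail_trivial Qlam" and "tail_trivial Qmu"
  shows "mutually_singular Qlam Qmu \<and>
    (\<exists>c1 c2 :: ereal. 0 \<le> c1 \<and> c1 < 1 \<and> 1 < c2 \<and> c2 \<le> \<infinity> \<and>
       measure Qlam {\<omega> \<in> paths.
         ((\<lambda>t. ereal (M_process (\<psi> (- mu)) mu t \<omega> / M_process (\<psi> (- lam)) lam t \<omega>)) \<longlongrightarrow> c1) at_top} = 1 \<and>
       measure Qmu {\<omega> \<in> paths.
         ((\<lambda>t. ereal (M_process (\<psi> (- mu)) mu t \<omega> / M_process (\<psi> (- lam)) lam t \<omega>)) \<longlongrightarrow> c2) at_top} = 1)"
proof -
  let ?\<phi> = "\<psi> (- lam)" and ?\<chi> = "\<psi> (- mu)"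
  let ?R = "\<lambda>t \<omega>. M_process ?\<chi> mu t \<omega> / M_process ?\<phi> lam t \<omega>"
  define E where "E c = {\<omega> \<in> paths. ((\<lambda>t. ereal (?R t \<omega>)) \<longlongrightarrow> c) at_top}" for c
  interpret diffusion_start m P x using assms(2,10) by unfold_locales
  have hL: "h_transformed (P x) ?\<phi> lam x Qlam" and hM: "h_transformed (P x) ?\<chi> mu x Qmu"
    using assms by (auto intro!: h_transformed_of_eigenfunction)
  interpret L: h_transformed "P x" ?\<phi> lam x Qlam by (rule hL)
  interpret M: h_transformed "P x" ?\<chi> mu x Qmu by (rule hM)
  have lam_mu: "h_transform_pair (P x) ?\<phi> lam x Qlam ?\<chi> mu Qmu"
    and mu_lam: "h_transform_pair (P x) ?\<chi> mu x Qmu ?\<phi> lam Qlam"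
    using hL hM by (auto intro: h_transform_pair.intro)
  have E_sets: "E c \<in> filt_infinity" if "c \<noteq> - \<infinity>" for c
    unfolding E_def by (rule M_ratio_limit_event[OF L.continuous M.continuous L.positive M.positive that])
  obtain c where c: "0 \<le> c" "c < 1"
    and lim_c: "AE \<omega> in Qlam. ((\<lambda>t. h_density ?\<chi> mu x t \<omega> / h_density ?\<phi> lam x t \<omega>) \<longlongrightarrow> c) at_top"
    using h_transform_pair.limit_less_1[OF lam_mu assms(13) \<open>lam \<noteq> mu\<close> returns] by blast
  obtain d where d: "0 \<le> d" "d < 1"
    and lim_d: "AE \<omega> in Qmu. ((\<lambda>t. h_density ?\<phi> lam x t \<omega> / h_density ?\<chi> mu x t \<omega>) \<longlongrightarrow> d) at_top"
    using h_transform_pair.limit_less_1[OF mu_lam assms(14) \<open>lam \<noteq> mu\<close>[symmetric] returns] by blast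
  define c2 where "c2 = (if d = 0 then \<infinity> else ereal (1 / d))"
  have c2: "1 < c2" "c2 \<noteq> - \<infinity>" using d by (auto simp: c2_def)
  have "AE \<omega> in Qlam. \<omega> \<in> E (ereal c)"
    using lim_c L.start AE_space
    by eventually_elim (simp add: E_def M_process_eq_h_density L.space_Q)
  then have Lc: "measure Qlam (E (ereal c)) = 1"
    using prob_space.prob_eq_1[OF L.prob_Q] E_sets[of "ereal c"] L.sets_Q by simp
  have "AE \<omega> in Qmu. \<omega> \<in> E c2"
    using lim_d M.start M.AE_immortal AE_space
  proof eventually_elim
    case (elim \<omega>)
    then have \<omega>: "\<omega> \<in> paths" by (simp add: M.space_Q)
    let ?S = "\<lambda>t. h_density ?\<phi> lam x t \<omega> / h_density ?\<chi> mu x t \<omega>"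
    have R: "?R t \<omega> = inverse (?S t)" for t
      using elim(2) by (simp add: M_process_eq_h_density)
    have immortal: "\<And>t. 0 \<le> t \<Longrightarrow> \<omega> t \<noteq> None" using elim(3) by blast
    have pos: "\<forall>\<^sub>F t in at_top. 0 < ?S t"
      using eventually_ge_at_top[of 0]
    proof eventually_elim
      case (elim t)
      show ?case
        by (intro divide_pos_pos L.density_pos[OF \<omega> elim immortal[OF elim]]
            M.density_pos[OF \<omega> elim immortal[OF elim]])
    qed
    have "((\<lambda>t. ereal (?R t \<omega>)) \<longlongrightarrow> c2) at_top"
    proof (cases "d = 0")
      case True
      have "\<forall>\<^sub>F t in at_top. ?S t \<in> {0<..} \<and> ?S t \<noteq> 0"
        using pos by eventually_elim (metis greaterThan_iff less_irrefl)
      then have "filterlim ?S (at_right 0) at_top"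
        unfolding filterlim_at using elim(1) True by simp
      then have "filterlim (\<lambda>t. inverse (?S t)) at_top at_top"
        using filterlim_inverse_at_top_right by (rule filterlim_compose[rotated])
      then show ?thesis
        using True unfolding R c2_def by (simp add: tendsto_PInfty_eq_at_top)
    next
      case False
      with elim(1) have "((\<lambda>t. inverse (?S t)) \<longlongrightarrow> inverse d) at_top"
        by (rule tendsto_inverse)
      then show ?thesis
        using False unfolding R c2_def by (simp add: inverse_eq_divide)
    qed
    with \<omega> show ?case by (simp add: E_def)
  qed
  then have Mc: "measure Qmu (E c2) = 1"
    using prob_space.prob_eq_1[OF M.prob_Q] E_sets[of c2] c2 M.sets_Q by simp
  have "E (ereal c) \<inter> E c2 = {}"
  proof -
    have "ereal c < 1" using c by (simp add: one_ereal_def)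
    then have "ereal c \<noteq> c2" using c2(1) by auto
    moreover have "ereal c = c2"
      if "((\<lambda>t. ereal (?R t \<omega>)) \<longlongrightarrow> ereal c) at_top" "((\<lambda>t. ereal (?R t \<omega>)) \<longlongrightarrow> c2) at_top" for \<omega>
      using that by (rule tendsto_unique[OF trivial_limit_at_top_linorder])
    ultimately show ?thesis unfolding E_def by blast
  qed
  interpret QL: prob_space Qlam by (rule L.prob_Q)
  interpret QM: prob_space Qmu by (rule M.prob_Q)
  have EL: "E c2 \<in> sets Qlam" "E (ereal c) \<in> sets Qlam" and EM: "E c2 \<in> sets Qmu"
    using E_sets c2 L.sets_Q M.sets_Q by simp_all
  have "E c2 \<subseteq> space Qlam - E (ereal c)"
    using sets.sets_into_space[OF EL(1)] \<open>E (ereal c) \<inter> E c2 = {}\<close> by blast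
  then have "measure Qlam (E c2) \<le> measure Qlam (space Qlam - E (ereal c))"
    by (rule QL.finite_measure_mono) (rule sets.compl_sets[OF EL(2)])
  also have "\<dots> = 0" using Lc QL.prob_compl[OF EL(2)] by simp
  finally have "measure Qlam (E c2) = 0" using measure_nonneg[of Qlam "E c2"] by linarith
  then have "emeasure Qlam (E c2) = 0" by (simp add: QL.emeasure_eq_measure)
  moreover have "emeasure Qmu (space Qmu - E c2) = 0"
    using Mc QM.prob_compl[OF EM] by (simp add: QM.emeasure_eq_measure)
  ultimately have singular: "mutually_singular Qlam Qmu"
    unfolding mutually_singular_def using L.sets_Q M.sets_Q EL(1) by simp blast
  show ?thesis
  proof (rule conjI[OF singular], rule exI[of _ "ereal c"], rule exI[of _ c2], intro conjI)
    show "0 \<le> ereal c" "ereal c < 1" using c by (simp_all add: one_ereal_def)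
    show "1 < c2" "c2 \<le> \<infinity>" using c2 by simp_all
  qed (rule Lc[unfolded E_def] Mc[unfolded E_def])+
qed

end
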